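(* Fix $\lambda\ge1$. For $\Lambda>1$ let \[ \sigma_\Lambda=\inf_{(u,v)\in\mathcal{X}}E_\Lambda(u,v), \] where \[ E_\Lambda(u,v)=\int_{-\infty}^{\infty}\left[\lambda^2\frac{(\dot u)^2}{2}+\frac{(\dot v)^2}{2}+\frac{(1-u^2-v^2)^2}{4}+\frac{\Lambda-1}{2}u^2v^2\right]dz \] and \[ \mathcal{X}=\left\{(u,v)\in W^{1,2}_{loc}(\mathbb{R})\times W^{1,2}_{loc}(\mathbb{R}):\ (u,v)\to(0,1)\ \text{as}\ z\to-\infty,\ (u,v)\to(1,0)\ \text{as}\ z\to+\infty\right\}. \] Then \[ \sigma_\Lambda=\frac{1}{3}\,\frac{1-\lambda^3}{1-\lambda^2}\,(\Lambda-1)^{\frac12}+\mathcal{O}(\Lambda-1)\quad\text{as}\ \Lambda\to1^+, \] where for $\lambda=1$ the quotient $\frac{1-\lambda^3}{1-\lambda^2}$ is understood as its limit $\frac{3}{2}$ as $\lambda\to1$.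
   Context: Here $\dot{}=d/dz$, functions are real-valued on $\mathbb{R}$, and $E_\Lambda$ takes values in $[0,+\infty]$. *)

theory Defs
  imports "HOL-Analysis.Analysis" "HOL-Library.Landau_Symbols"
begin

definition L2_loc :: "(real \<Rightarrow> real) \<Rightarrow> bool" where
  "L2_loc f \<longleftrightarrow> f \<in> borel_measurable lebesgue \<and>
     (\<forall>a b. set_integrable lebesgue {a..b} (\<lambda>x. (f x)\<^sup>2))"

definition test_function :: "(real \<Rightarrow> real) \<Rightarrow> bool" where
  "test_function \<phi> \<longleftrightarrow> \<phi> C1_differentiable_on UNIV \<and> compact (closure {x. \<phi> x \<noteq> 0})"

(* Distributional derivative on the line, tested against compactly supported C^1 functions
   as in Brezis, Functional Analysis, Sobolev Spaces and PDE, Section 8.2.  The Bochner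
   integrals are meaningful when u and g are locally integrable; the predicate is only used
   for u and g in L2_loc. *)
definition has_weak_derivative :: "(real \<Rightarrow> real) \<Rightarrow> (real \<Rightarrow> real) \<Rightarrow> bool" where
  "has_weak_derivative u g \<longleftrightarrow>
     (\<forall>\<phi>. test_function \<phi> \<longrightarrow>
        (LINT x|lebesgue. u x * deriv \<phi> x) = - (LINT x|lebesgue. g x * \<phi> x))"

definition W12_loc :: "(real \<Rightarrow> real) set" where
  "W12_loc = {u. L2_loc u \<and> (\<exists>g. L2_loc g \<and> has_weak_derivative u g)}"

(* Weak derivatives are unique up to null sets, so for u in W12_loc the choice of g
   does not affect any integral below. *)
definition weak_deriv :: "(real \<Rightarrow> real) \<Rightarrow> real \<Rightarrow> real" where
  "weak_deriv u = (SOME g. L2_loc g \<and> has_weak_derivative u g)"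

(* lam is the parameter written lambda in the mathematics.  The integrand is nonnegative for
   \<Lambda> \<ge> 1, so the truncation in ennreal loses nothing there. *)
definition energy :: "real \<Rightarrow> real \<Rightarrow> (real \<Rightarrow> real) \<Rightarrow> (real \<Rightarrow> real) \<Rightarrow> ennreal" where
  "energy lam \<Lambda> u v =
     (\<integral>\<^sup>+ z. ennreal (lam\<^sup>2 * ((weak_deriv u z)\<^sup>2 / 2) + (weak_deriv v z)\<^sup>2 / 2
                  + (1 - (u z)\<^sup>2 - (v z)\<^sup>2)\<^sup>2 / 4
                  + (\<Lambda> - 1) / 2 * (u z)\<^sup>2 * (v z)\<^sup>2) \<partial>lebesgue)"

(* Sobolev functions on the line are identified with their continuous representatives;
   this is what gives the limits at infinity a pointwise meaning. *)
definition admissible :: "((real \<Rightarrow> real) \<times> (real \<Rightarrow> real)) set" where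
  "admissible = {(u, v). u \<in> W12_loc \<and> v \<in> W12_loc
      \<and> continuous_on UNIV u \<and> continuous_on UNIV v
      \<and> ((\<lambda>z. (u z, v z)) \<longlongrightarrow> (0, 1)) at_bot
      \<and> ((\<lambda>z. (u z, v z)) \<longlongrightarrow> (1, 0)) at_top}"

definition sigma_inf :: "real \<Rightarrow> real \<Rightarrow> ennreal" where
  "sigma_inf lam \<Lambda> = (INF (u, v)\<in>admissible. energy lam \<Lambda> u v)"

definition quotient_coeff :: "real \<Rightarrow> real" where
  "quotient_coeff lam = (if lam = 1 then 3 / 2 else (1 - lam ^ 3) / (1 - lam ^ 2))"

end

(* Set d = sqrt (Lambda - 1).  On the circle u^2 + v^2 = 1 the minimal energy of a connection is the
   length of the quarter circle for the metric d |u v| sqrt (lam^2 du^2 + dv^2), which is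
   d * quotient_coeff lam / 3; the curve of minimal energy on the circle attains it.
   For the lower bound, a function F with Fu^2 / lam^2 + Fv^2 <= 2 W, where W is the potential,
   calibrates the energy: the energy is at least F(1,0) - F(0,1).  With t = u^2 + v^2 - 1, a first
   calibration depending on t alone shows that low energy confines the curve to |t| < 1/2.
   On that annulus extend the length function of the circle so that it satisfies the inequality
   up to terms of order d^2 (u^2 v^2 |t| + t^2); they are absorbed by the penalty t^2 / 4 after
   multiplying by 1 - d, which costs O(d^2). *)

theory Submission
  imports Defs
begin

section \<open>Weak derivatives on the line\<close>

text \<open>The curve on the circle gives the upper bound without error, so all of the error comes
  from the lower bound, where the extension of the length function is the delicate point. Extended
  as a function of v alone it fails already on the circle: its squared gradient there is d^2 v^2 m^2
  with m^2 = lam^2 v^2 + u^2, instead of d^2 u^2 v^2. Adding t * k(v^2) keeps the values on the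
  circle and corrects the normal derivative, so that at t = 0 the gradient is (lam^2 u', v') of the
  optimal curve, up to the factor 1 - d. The error linear in t then carries the factor u^2 v^2. This
  is essential: d^2 |t| alone is not dominated by t^2 near t = 0, whereas d^2 u^2 v^2 |t| is at most
  a multiple of d t^2 + d^3 u^2 v^2, and the last term is a relative error of order d. Hence the
  factor 1 - d. These estimates need u and v bounded, hence the confinement. Admissible curves are
  merely Sobolev and their derivative is an arbitrary choice of representative, so calibration has
  to rest on increments written as integrals.\<close>

lemma L2_loc_set_integrable_sq:
  assumes "L2_loc f"
  shows "set_integrable lebesgue {a..b} (\<lambda>x. (f x)\<^sup>2)"
  using assms by (auto simp: L2_loc_def)

lemma L2_loc_set_integrable:
  assumes "L2_loc f"
  shows "set_integrable lebesgue {a..b} f"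
proof -
  have m[measurable]: "f \<in> borel_measurable lebesgue"
    using assms by (simp add: L2_loc_def)
  have c: "set_integrable lebesgue {a..b} (\<lambda>x. 1 + (f x)\<^sup>2)"
    by (intro set_integral_add L2_loc_set_integrable_sq assms absolutely_integrable_continuous_real
        continuous_intros)
  show ?thesis
    unfolding set_integrable_def
  proof (rule Bochner_Integration.integrable_bound[OF c[unfolded set_integrable_def]])
    show "(\<lambda>x. indicat_real {a..b} x *\<^sub>R f x) \<in> borel_measurable lebesgue"
      by (intro borel_measurable_scaleR borel_measurable_indicator m) simp
    have "\<bar>y\<bar> \<le> 1 + y\<^sup>2" for y :: real
    proof -
      have "0 \<le> (\<bar>y\<bar> - 1)\<^sup>2" by simp
      also have "\<dots> = y\<^sup>2 - 2 * \<bar>y\<bar> + 1" by (simp add: power2_eq_square algebra_simps)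
      finally have "2 * \<bar>y\<bar> \<le> 1 + y\<^sup>2" by simp
      then show ?thesis by linarith
    qed
    then show "AE x in lebesgue. norm (indicat_real {a..b} x *\<^sub>R f x)
        \<le> norm (indicat_real {a..b} x *\<^sub>R (1 + (f x)\<^sup>2))"
      by (auto simp: indicator_def)
  qed
qed

lemma set_lebesgue_integral_Icc_eq:
  fixes f :: "real \<Rightarrow> real"
  assumes "set_integrable lebesgue {a..b} f"
  shows "f integrable_on {a..b}" "(LINT x:{a..b}|lebesgue. f x) = integral {a..b} f"
  using assms set_lebesgue_integral_eq_integral(1,2)[OF assms] by auto

lemma L2_loc_continuous:
  assumes "continuous_on UNIV f"
  shows "L2_loc f"
  unfolding L2_loc_def
proof (intro conjI allI)
  show "f \<in> borel_measurable lebesgue"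
    using borel_measurable_continuous_onI[OF assms] by (simp add: measurable_completion)
  show "set_integrable lebesgue {a..b} (\<lambda>x. (f x)\<^sup>2)" for a b
    by (intro absolutely_integrable_continuous_real continuous_intros continuous_on_subset[OF assms]) auto
qed

lemma LINT_compact_support:
  fixes f :: "real \<Rightarrow> real"
  assumes "set_integrable lebesgue {a..b} f" "\<And>x. x \<notin> {a..b} \<Longrightarrow> f x = 0"
  shows "(LINT x|lebesgue. f x) = integral {a..b} f"
proof -
  have "(LINT x|lebesgue. f x) = (LINT x:{a..b}|lebesgue. f x)"
    unfolding set_lebesgue_integral_def
    by (rule Bochner_Integration.integral_cong) (use assms(2) in \<open>auto simp: indicator_def\<close>)
  then show ?thesis using set_lebesgue_integral_Icc_eq[OF assms(1)] by simp
qed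

lemma test_function_support:
  assumes "test_function \<phi>"
  obtains R where "R > 0" "\<And>x. x \<notin> {-R..R} \<Longrightarrow> \<phi> x = 0" "\<And>x. x \<notin> {-R..R} \<Longrightarrow> deriv \<phi> x = 0"
    "\<phi> (-R) = 0" "\<phi> R = 0"
proof -
  from assms have "bounded (closure {x. \<phi> x \<noteq> 0})"
    by (auto simp: test_function_def compact_imp_bounded)
  then obtain R where R: "R > 0" "\<And>x. x \<in> closure {x. \<phi> x \<noteq> 0} \<Longrightarrow> norm x \<le> R"
    by (auto simp: bounded_pos)
  have z: "\<phi> x = 0" if "\<bar>x\<bar> > R" for x
    using R(2)[of x] that closure_subset[of "{x. \<phi> x \<noteq> 0}"] by fastforce
  have "deriv \<phi> x = 0" if "\<bar>x\<bar> > R" for x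
  proof -
    have "(\<phi> has_field_derivative 0) (at x)"
    proof (rule has_field_derivative_transform_within_open[where S = "{x. \<bar>x\<bar> > R}"])
      show "((\<lambda>_. 0) has_field_derivative 0) (at x)" by simp
      show "open {x::real. \<bar>x\<bar> > R}" by (intro open_Collect_less continuous_intros)
    qed (use that z in auto)
    then show ?thesis by (rule DERIV_imp_deriv)
  qed
  \<comment> \<open>\<open>z\<close> covers only \<open>\<bar>x\<bar> > R\<close>. One more unit
    makes \<open>\<phi>\<close> vanish at the endpoints too, which removes the boundary terms in an
    integration by parts.\<close>
  then show ?thesis using z R(1) by (intro that[of "R+1"]) auto
qed

lemma test_function_deriv:
  assumes "test_function \<phi>"
  shows "(\<phi> has_real_derivative deriv \<phi> x) (at x)" "continuous_on UNIV (deriv \<phi>)"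
    "continuous_on UNIV \<phi>"
proof -
  obtain D where D: "\<And>x. (\<phi> has_vector_derivative D x) (at x)" "continuous_on UNIV D"
    using assms by (auto simp: test_function_def C1_differentiable_on_def)
  have D': "(\<phi> has_real_derivative D x) (at x)" for x
    using D(1) by (simp add: has_real_derivative_iff_has_vector_derivative)
  then have "deriv \<phi> = D" using DERIV_imp_deriv by blast
  then show "(\<phi> has_real_derivative deriv \<phi> x) (at x)" "continuous_on UNIV (deriv \<phi>)"
    using D' D by auto
  show "continuous_on UNIV \<phi>"
    using D' by (meson DERIV_isCont continuous_at_imp_continuous_on)
qed

lemma has_weak_derivative_C1:
  assumes "\<And>x. (u has_real_derivative g x) (at x)" "continuous_on UNIV g"
  shows "has_weak_derivative u g"
  unfolding has_weak_derivative_def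
proof (intro allI impI)
  fix \<phi> assume t: "test_function \<phi>"
  obtain R where R: "R > 0" "\<And>x. x \<notin> {-R..R} \<Longrightarrow> \<phi> x = 0" "\<And>x. x \<notin> {-R..R} \<Longrightarrow> deriv \<phi> x = 0"
    "\<phi> (-R) = 0" "\<phi> R = 0"
    using test_function_support[OF t] by blast
  note d = test_function_deriv[OF t]
  have cu: "continuous_on UNIV u"
    using assms(1) by (meson DERIV_isCont continuous_at_imp_continuous_on)
  have c: "continuous_on {-R..R} (\<lambda>x. u x * deriv \<phi> x)" "continuous_on {-R..R} (\<lambda>x. g x * \<phi> x)"
    by (intro continuous_intros continuous_on_subset[OF cu] continuous_on_subset[OF d(2)]
        continuous_on_subset[OF d(3)] continuous_on_subset[OF assms(2)]; simp)+
  have i: "(LINT x|lebesgue. u x * deriv \<phi> x) = integral {-R..R} (\<lambda>x. u x * deriv \<phi> x)"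
      "(LINT x|lebesgue. g x * \<phi> x) = integral {-R..R} (\<lambda>x. g x * \<phi> x)"
    by (intro LINT_compact_support absolutely_integrable_continuous_real c; use R in auto)+
  have "((\<lambda>x. u x * deriv \<phi> x + g x * \<phi> x) has_integral (u R * \<phi> R - u (-R) * \<phi> (-R))) {-R..R}"
  proof (rule fundamental_theorem_of_calculus)
    show "-R \<le> R" using R by simp
    show "((\<lambda>x. u x * \<phi> x) has_vector_derivative u x * deriv \<phi> x + g x * \<phi> x) (at x within {-R..R})" for x
      using DERIV_subset[OF DERIV_mult[OF assms(1)[of x] d(1)[of x]], of "{-R..R}"]
      by (simp add: has_real_derivative_iff_has_vector_derivative algebra_simps)
  qed
  then have "integral {-R..R} (\<lambda>x. u x * deriv \<phi> x + g x * \<phi> x) = 0"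
    using R by (simp add: integral_unique)
  moreover have "integral {-R..R} (\<lambda>x. u x * deriv \<phi> x + g x * \<phi> x)
     = integral {-R..R} (\<lambda>x. u x * deriv \<phi> x) + integral {-R..R} (\<lambda>x. g x * \<phi> x)"
    by (intro Henstock_Kurzweil_Integration.integral_add integrable_continuous_real c)
  ultimately show "(LINT x|lebesgue. u x * deriv \<phi> x) = - (LINT x|lebesgue. g x * \<phi> x)"
    using i by simp
qed

section \<open>C1 cutoffs, one-sided averages and increments\<close>

definition pos2 :: "real \<Rightarrow> real" where "pos2 t = (max 0 t)\<^sup>2"

lemma DERIV_pos2: "(pos2 has_real_derivative 2 * max 0 t) (at t)"
proof (cases t "0::real" rule: linorder_cases)
  case less
  have "((\<lambda>_. 0) has_real_derivative 0) (at t)" by simp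
  then have "(pos2 has_real_derivative 0) (at t)"
    by (rule has_field_derivative_transform_within_open[where S = "{..<0}"])
       (use less in \<open>auto simp: pos2_def\<close>)
  then show ?thesis using less by simp
next
  case greater
  have "((\<lambda>t. t\<^sup>2) has_real_derivative 2 * t) (at t)" by (auto intro!: derivative_eq_intros)
  then have "(pos2 has_real_derivative 2 * t) (at t)"
    by (rule has_field_derivative_transform_within_open[where S = "{0<..}"])
       (use greater in \<open>auto simp: pos2_def\<close>)
  then show ?thesis using greater by simp
next
  case equal
  have "((\<lambda>h. (pos2 h - pos2 0) / (h - 0)) \<longlongrightarrow> 0) (at 0)"
  proof (rule Lim_null_comparison[where g = abs])
    have "norm ((pos2 h - pos2 0) / (h - 0)) \<le> \<bar>h\<bar>" for h
      by (auto simp: pos2_def max_def power2_eq_square)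
    then show "\<forall>\<^sub>F h in at 0. norm ((pos2 h - pos2 0) / (h - 0)) \<le> \<bar>h\<bar>" by simp
    show "(abs \<longlongrightarrow> (0::real)) (at 0)" using tendsto_rabs[OF tendsto_ident_at, of 0 UNIV] by (simp add: )
  qed
  then show ?thesis using equal by (simp add: has_field_derivative_iff)
qed

text \<open>A second difference of \<open>pos2\<close>: rising from 0 to 1 on \<open>[0, 2]\<close> and, unlike a piecewise linear
  step, of class C1, as test functions have to be.\<close>

definition smooth_step :: "real \<Rightarrow> real" where
  "smooth_step t = (pos2 t - 2 * pos2 (t - 1) + pos2 (t - 2)) / 2"

definition hat :: "real \<Rightarrow> real" where
  "hat t = max 0 t - 2 * max 0 (t - 1) + max 0 (t - 2)"

lemma hat_nonneg: "hat t \<ge> 0"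
  by (auto simp: hat_def max_def)

lemma hat_outside: "t \<notin> {0..2} \<Longrightarrow> hat t = 0"
  by (auto simp: hat_def max_def)

lemma continuous_hat: "continuous_on S hat"
  unfolding hat_def by (intro continuous_intros)

lemma DERIV_smooth_step: "(smooth_step has_real_derivative hat t) (at t)"
  unfolding smooth_step_def hat_def
  by (auto intro!: derivative_eq_intros DERIV_chain2[where f = pos2] DERIV_pos2 simp: max_def)

lemma smooth_step_le: "t \<le> 0 \<Longrightarrow> smooth_step t = 0"
  by (auto simp: smooth_step_def pos2_def max_def)

lemma smooth_step_ge: "t \<ge> 2 \<Longrightarrow> smooth_step t = 1"
  by (auto simp: smooth_step_def pos2_def max_def power2_eq_square field_simps)

lemma smooth_step_bounds: "0 \<le> smooth_step t" "smooth_step t \<le> 1"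
proof -
  have mono: "smooth_step s \<le> smooth_step t" if "s \<le> t" for s t
    using that DERIV_smooth_step hat_nonneg by (intro DERIV_nonneg_imp_nondecreasing[of s t smooth_step]) blast+
  show "0 \<le> smooth_step t" using mono[of "min t 0" t] smooth_step_le[of "min t 0"] by simp
  show "smooth_step t \<le> 1" using mono[of t "max t 2"] smooth_step_ge[of "max t 2"] by simp
qed

text \<open>The kernel is a one-sided approximate identity: nonnegative, supported in
  \<open>{x..x + 2 * h}\<close>, and of mass 1 because its primitive, a rescaled
  \<open>smooth_step\<close>, rises from 0 to 1 there. Continuity of \<open>u\<close> at
  \<open>x\<close> does the rest.\<close>

lemma step_average_tendsto:
  fixes u :: "real \<Rightarrow> real"
  assumes cu: "continuous_on UNIV u"
  shows "((\<lambda>h. LINT t|lebesgue. u t * (hat ((t - x) / h) / h)) \<longlongrightarrow> u x) (at_right 0)"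
proof (rule tendstoI)
  fix e :: real assume e: "e > 0"
  from cu have "isCont u x" by (simp add: continuous_on_eq_continuous_at)
  then obtain d where d: "d > 0" "\<And>t. dist t x < d \<Longrightarrow> dist (u t) (u x) < e / 2"
    using e by (metis continuous_at_eps_delta half_gt_zero)
  have "dist (LINT t|lebesgue. u t * (hat ((t - x) / h) / h)) (u x) < e" if h: "0 < h" "h < d / 2" for h
  proof -
    have ch: "continuous_on {x..x + 2 * h} (\<lambda>t. hat ((t - x) / h) / h)"
      using h by (intro continuous_intros continuous_on_compose2[OF continuous_hat]) auto
    have cuh: "continuous_on {x..x + 2 * h} (\<lambda>t. u t * (hat ((t - x) / h) / h))"
      by (intro continuous_intros ch continuous_on_subset[OF cu]) auto
    have 1: "(LINT t|lebesgue. u t * (hat ((t - x) / h) / h)) = integral {x..x + 2 * h} (\<lambda>t. u t * (hat ((t - x) / h) / h))"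
    proof (rule LINT_compact_support)
      show "u t * (hat ((t - x) / h) / h) = 0" if "t \<notin> {x..x + 2 * h}" for t
        using that h hat_outside[of "(t - x) / h"] by (auto simp: field_simps)
    qed (rule absolutely_integrable_continuous_real[OF cuh])
    have 2: "((\<lambda>t. hat ((t - x) / h) / h) has_integral smooth_step ((x + 2 * h - x) / h) - smooth_step ((x - x) / h)) {x..x + 2 * h}"
    proof (rule fundamental_theorem_of_calculus)
      fix t
      have "((\<lambda>t. smooth_step ((t - x) / h)) has_real_derivative hat ((t - x) / h) * (1 / h)) (at t within {x..x + 2 * h})"
        using h by (intro DERIV_chain2[OF DERIV_smooth_step]) (auto intro!: derivative_eq_intros)
      then show "((\<lambda>t. smooth_step ((t - x) / h)) has_vector_derivative hat ((t - x) / h) / h) (at t within {x..x + 2 * h})"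
        by (simp add: has_real_derivative_iff_has_vector_derivative)
    qed (use h in simp)
    then have 3: "integral {x..x + 2 * h} (\<lambda>t. hat ((t - x) / h) / h) = 1"
      using h smooth_step_le[of 0] smooth_step_ge[of 2] integral_unique[OF 2] by simp
    have "integral {x..x + 2 * h} (\<lambda>t. u t * (hat ((t - x) / h) / h)) - u x
        = integral {x..x + 2 * h} (\<lambda>t. u t * (hat ((t - x) / h) / h)) - integral {x..x + 2 * h} (\<lambda>t. u x * (hat ((t - x) / h) / h))"
      by (subst integral_mult_right) (simp only: 3 mult_1_right)
    also have "\<dots> = integral {x..x + 2 * h} (\<lambda>t. u t * (hat ((t - x) / h) / h) - u x * (hat ((t - x) / h) / h))"
      by (intro Henstock_Kurzweil_Integration.integral_diff[symmetric] integrable_continuous_real cuh continuous_intros ch)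
    finally have 4: "\<bar>integral {x..x + 2 * h} (\<lambda>t. u t * (hat ((t - x) / h) / h)) - u x\<bar> = \<bar>\<dots>\<bar>" by simp
    also have "\<dots> \<le> integral {x..x + 2 * h} (\<lambda>t. e / 2 * (hat ((t - x) / h) / h))"
      unfolding real_norm_def[symmetric]
    proof (rule integral_norm_bound_integral)
      fix t assume t: "t \<in> {x..x + 2 * h}"
      then have "\<bar>u t - u x\<bar> \<le> e / 2" using d(2)[of t] h by (auto simp: dist_real_def)
      then have "\<bar>u t - u x\<bar> * (hat ((t - x) / h) / h) \<le> e / 2 * (hat ((t - x) / h) / h)"
        using h hat_nonneg by (intro mult_right_mono) auto
      then show "norm (u t * (hat ((t - x) / h) / h) - u x * (hat ((t - x) / h) / h)) \<le> e / 2 * (hat ((t - x) / h) / h)"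
        using h hat_nonneg[of "(t - x) / h"]
        by (simp add: left_diff_distrib[symmetric] abs_mult del: times_divide_eq_right)
    qed (intro integrable_continuous_real cuh continuous_intros ch)+
    also have "\<dots> = e / 2" by (subst integral_mult_right) (simp only: 3 mult_1_right)
    finally show ?thesis unfolding 1 dist_real_def using e by linarith
  qed
  then show "\<forall>\<^sub>F h in at_right 0. dist (LINT t|lebesgue. u t * (hat ((t - x) / h) / h)) (u x) < e"
    using d(1) by (intro eventually_at_rightI[of 0 "d / 2"]) auto
qed

text \<open>The weak identity is tested with a plateau that rises just after \<open>x\<close> and
  falls just after \<open>y\<close>. As the width \<open>h\<close> of the two ramps shrinks, one
  side averages \<open>u\<close> near the endpoints and the other becomes an integral over the
  interval.\<close>

lemma weak_derivative_increment:
  fixes u p :: "real \<Rightarrow> real"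
  assumes cu: "continuous_on UNIV u" and p: "L2_loc p" and w: "has_weak_derivative u p" and xy: "x \<le> y"
  shows "u y - u x = integral {x..y} p"
proof -
  define \<phi> where "\<phi> h t = smooth_step ((t - x) / h) - smooth_step ((t - y) / h)" for h t
  define \<phi>' where "\<phi>' h t = hat ((t - x) / h) / h - hat ((t - y) / h) / h" for h t
  have D: "(\<phi> h has_real_derivative \<phi>' h t) (at t)" if "h > 0" for h t
  proof -
    have "((\<lambda>t. smooth_step ((t - z) / h)) has_real_derivative hat ((t - z) / h) * (1 / h)) (at t)" for z
      using that by (intro DERIV_chain2[OF DERIV_smooth_step]) (auto intro!: derivative_eq_intros)
    from DERIV_diff[OF this this] show ?thesis unfolding \<phi>_def \<phi>'_def by simp
  qed
  have c': "continuous_on UNIV (\<phi>' h)" if "h > 0" for h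
    unfolding \<phi>'_def using that by (intro continuous_intros continuous_on_compose2[OF continuous_hat]) auto
  have out: "\<phi> h t = 0" if h: "h > 0" and t: "t \<notin> {x..y + 2 * h}" for h t
  proof (cases "t < x")
    case True
    then have "t - x \<le> 0" "t - y \<le> 0" using xy by auto
    then show ?thesis using h by (simp add: \<phi>_def smooth_step_le divide_nonpos_pos)
  next
    case False
    then have "(t - x) / h \<ge> 2" "(t - y) / h \<ge> 2" using t h xy by (auto simp: field_simps)
    then show ?thesis by (simp add: \<phi>_def smooth_step_ge)
  qed
  have test: "test_function (\<phi> h)" if h: "h > 0" for h
    unfolding test_function_def C1_differentiable_on_def
  proof (intro conjI exI[of _ "\<phi>' h"] ballI)
    show "(\<phi> h has_vector_derivative \<phi>' h t) (at t)" for t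
      using D[OF h] by (simp add: has_real_derivative_iff_has_vector_derivative)
    have "{t. \<phi> h t \<noteq> 0} \<subseteq> {x..y + 2 * h}" using out[OF h] by blast
    then have "bounded {t. \<phi> h t \<noteq> 0}" using bounded_closed_interval bounded_subset by blast
    then show "compact (closure {t. \<phi> h t \<noteq> 0})" by simp
  qed (rule c'[OF h])
  have d: "deriv (\<phi> h) = \<phi>' h" if "h > 0" for h
    using D[OF that] DERIV_imp_deriv by blast
  have split: "(LINT t|lebesgue. u t * \<phi>' h t)
      = (LINT t|lebesgue. u t * (hat ((t - x) / h) / h)) - (LINT t|lebesgue. u t * (hat ((t - y) / h) / h))"
    if h: "h > 0" for h
  proof -
    have i: "integrable lebesgue (\<lambda>t. u t * (hat ((t - z) / h) / h))" for z
    proof -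
      have "set_integrable lebesgue {z..z + 2 * h} (\<lambda>t. u t * (hat ((t - z) / h) / h))"
        using h by (intro absolutely_integrable_continuous_real continuous_intros continuous_on_compose2[OF continuous_hat]
            continuous_on_subset[OF cu]) auto
      moreover have "indicat_real {z..z + 2 * h} t *\<^sub>R (u t * (hat ((t - z) / h) / h)) = u t * (hat ((t - z) / h) / h)" for t
        using h hat_outside[of "(t - z) / h"] by (auto simp: indicator_def field_simps)
      ultimately show ?thesis unfolding set_integrable_def by (simp only:)
    qed
    show ?thesis
      unfolding \<phi>'_def by (subst Bochner_Integration.integral_diff[OF i i, symmetric]) (simp only: right_diff_distrib)
  qed
  have h0: "\<forall>\<^sub>F h in at_right (0::real). h > 0"
    by (simp add: eventually_at_filter)
  have "((\<lambda>h. (LINT t|lebesgue. u t * (hat ((t - x) / h) / h)) - (LINT t|lebesgue. u t * (hat ((t - y) / h) / h))) \<longlongrightarrow> u x - u y) (at_right 0)"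
    by (intro tendsto_diff step_average_tendsto cu)
  moreover have "\<forall>\<^sub>F h in at_right 0. (LINT t|lebesgue. u t * (hat ((t - x) / h) / h)) - (LINT t|lebesgue. u t * (hat ((t - y) / h) / h))
      = - (LINT t|lebesgue. p t * \<phi> h t)"
    using h0
  proof eventually_elim
    case (elim h)
    then show ?case using w test[OF elim] d[OF elim] split[OF elim]
      by (auto simp: has_weak_derivative_def)
  qed
  ultimately have lim1: "((\<lambda>h. - (LINT t|lebesgue. p t * \<phi> h t)) \<longlongrightarrow> u x - u y) (at_right 0)"
    by (rule Lim_transform_eventually)
  have m[measurable]: "p \<in> borel_measurable lebesgue" using p by (simp add: L2_loc_def)
  \<comment> \<open>Dominated convergence is applied along a sequence; widths at most 1 keep every
    support inside \<open>{x..y + 2}\<close>.\<close>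
  define h where "h n = 1 / real (Suc n)" for n
  have hp: "h n > 0" "h n \<le> 1" for n by (auto simp: h_def)
  have h_lim: "h \<longlonglongrightarrow> 0"
    unfolding h_def using LIMSEQ_inverse_real_of_nat by (simp add: inverse_eq_divide)
  then have h_at: "filterlim h (at_right 0) sequentially"
    using hp by (auto simp: filterlim_at less_imp_neq[THEN not_sym])
  have lim2: "(\<lambda>n. LINT t|lebesgue. p t * \<phi> (h n) t) \<longlonglongrightarrow> (LINT t|lebesgue. indicator {x<..y} t * p t)"
  proof (rule integral_dominated_convergence[where w = "\<lambda>t. indicator {x..y + 2} t *\<^sub>R \<bar>p t\<bar>"])
    show "integrable lebesgue (\<lambda>t. indicator {x..y + 2} t *\<^sub>R \<bar>p t\<bar>)"
      using set_integrable_abs[OF L2_loc_set_integrable[OF p]] by (simp add: set_integrable_def)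
    show "(\<lambda>t. p t * \<phi> (h n) t) \<in> borel_measurable lebesgue" for n
    proof -
      have "continuous_on UNIV (\<phi> (h n))" using test_function_deriv(3)[OF test[OF hp(1)]] .
      then have [measurable]: "\<phi> (h n) \<in> borel_measurable lebesgue"
        by (simp add: borel_measurable_continuous_onI measurable_completion)
      show ?thesis by measurable
    qed
    show "AE t in lebesgue. norm (p t * \<phi> (h n) t) \<le> indicator {x..y + 2} t *\<^sub>R \<bar>p t\<bar>" for n
    proof (rule AE_I2)
      fix t
      show "norm (p t * \<phi> (h n) t) \<le> indicator {x..y + 2} t *\<^sub>R \<bar>p t\<bar>"
      proof (cases "t \<in> {x..y + 2}")
        case True
        have "\<bar>\<phi> (h n) t\<bar> \<le> 1"
          using smooth_step_bounds[of "(t - x) / h n"] smooth_step_bounds[of "(t - y) / h n"] by (auto simp: \<phi>_def)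
        then show ?thesis using True mult_left_le[of "\<bar>\<phi> (h n) t\<bar>" "\<bar>p t\<bar>"] by (simp add: abs_mult)
      next
        case False
        then have "\<phi> (h n) t = 0" using hp[of n] by (intro out) auto
        then show ?thesis by simp
      qed
    qed
    show "AE t in lebesgue. (\<lambda>n. p t * \<phi> (h n) t) \<longlonglongrightarrow> indicator {x<..y} t * p t"
    proof (rule AE_I2)
      fix t
      \<comment> \<open>\<open>smooth_step\<close> is 0 at 0, so the limiting half-line excludes
        \<open>z\<close>. The half-open interval obtained this way differs from
        \<open>{x..y}\<close> by a null set.\<close>
      have s: "(\<lambda>n. smooth_step ((t - z) / h n)) \<longlonglongrightarrow> indicator {z<..} t" for z
      proof (cases "t \<le> z")
        case True
        then have "smooth_step ((t - z) / h n) = 0" for n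
          using hp[of n] by (intro smooth_step_le) (auto simp: divide_nonpos_pos)
        then show ?thesis using True by simp
      next
        case False
        then have "\<forall>\<^sub>F n in sequentially. h n < (t - z) / 2"
          using h_lim by (intro order_tendstoD(2)) auto
        then have "\<forall>\<^sub>F n in sequentially. smooth_step ((t - z) / h n) = 1"
          by eventually_elim (use hp in \<open>auto intro!: smooth_step_ge simp: field_simps\<close>)
        then show ?thesis using False by (simp add: tendsto_eventually)
      qed
      have "(\<lambda>n. p t * \<phi> (h n) t) \<longlonglongrightarrow> p t * (indicator {x<..} t - indicator {y<..} t)"
        unfolding \<phi>_def by (intro tendsto_intros s)
      then show "(\<lambda>n. p t * \<phi> (h n) t) \<longlonglongrightarrow> indicator {x<..y} t * p t"
        using xy by (auto simp: indicator_def split: if_splits)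
    qed
  qed (auto intro!: borel_measurable_times borel_measurable_indicator m)
  have "(LINT t|lebesgue. indicator {x<..y} t * p t) = (LINT t:{x..y}|lebesgue. p t)"
    unfolding set_lebesgue_integral_def
  proof (rule integral_cong_AE)
    have "{x} \<in> null_sets lebesgue" by (simp add: negligible_iff_null_sets[symmetric])
    then have "AE t in lebesgue. t \<noteq> x" by (rule AE_I') auto
    then show "AE t in lebesgue. indicator {x<..y} t * p t = indicator {x..y} t *\<^sub>R p t"
      by eventually_elim (auto simp: indicator_def)
  qed (auto intro!: borel_measurable_times borel_measurable_indicator m)
  also have "\<dots> = integral {x..y} p"
    by (intro set_lebesgue_integral_Icc_eq L2_loc_set_integrable p)
  finally have "(\<lambda>n. - (LINT t|lebesgue. p t * \<phi> (h n) t)) \<longlonglongrightarrow> - integral {x..y} p"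
    using tendsto_minus[OF lim2] by simp
  then have "- integral {x..y} p = u x - u y"
    using filterlim_compose[OF lim1 h_at] LIMSEQ_unique by blast
  then show ?thesis by simp
qed

section \<open>Almost everywhere uniqueness of weak derivatives\<close>

lemma AE_zero_if_tail_integrals_zero:
  fixes f :: "real \<Rightarrow> real"
  assumes f: "integrable lborel f" and z: "\<And>x. (LINT t:{x<..}|lborel. f t) = 0"
  shows "AE t in lborel. f t = 0"
proof -
  have [measurable]: "f \<in> borel_measurable borel" using f by auto
  \<comment> \<open>The positive and negative parts of \<open>f\<close> are densities of two finite
    measures that agree on all half-lines, hence are equal. Their densities then agree almost
    everywhere, and a number whose positive and negative parts coincide is 0.\<close>
  define M where "M = density lborel (\<lambda>t. ennreal (max 0 (f t)))"
  define N where "N = density lborel (\<lambda>t. ennreal (max 0 (- f t)))"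
  have i: "integrable lborel (\<lambda>t. indicat_real {x<..} t * max 0 (f t))"
     "integrable lborel (\<lambda>t. indicat_real {x<..} t * max 0 (- f t))" for x
    by (rule Bochner_Integration.integrable_bound[OF f]; auto simp: indicator_def)+
  have e: "emeasure M {x<..} = ennreal (LINT t|lborel. indicat_real {x<..} t * max 0 (f t))"
     "emeasure N {x<..} = ennreal (LINT t|lborel. indicat_real {x<..} t * max 0 (- f t))" for x
    unfolding M_def N_def
    by (subst emeasure_density; (simp; fail)?; subst nn_integral_eq_integral[symmetric, OF i(1)] nn_integral_eq_integral[symmetric, OF i(2)];
       auto simp: indicator_def intro!: nn_integral_cong)+
  have "M = N"
  proof (rule measure_eqI_lessThan)
    fix x
    have "(LINT t|lborel. indicat_real {x<..} t * max 0 (f t)) - (LINT t|lborel. indicat_real {x<..} t * max 0 (- f t))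
        = (LINT t|lborel. indicat_real {x<..} t * max 0 (f t) - indicat_real {x<..} t * max 0 (- f t))"
      by (rule Bochner_Integration.integral_diff[OF i, symmetric])
    also have "\<dots> = (LINT t:{x<..}|lborel. f t)"
      unfolding set_lebesgue_integral_def
      by (rule Bochner_Integration.integral_cong) (auto simp: indicator_def)
    finally show "emeasure M {x<..} = emeasure N {x<..}" using z e by simp
    show "emeasure M {x<..} < \<infinity>" using e by simp
  qed (auto simp: M_def N_def)
  then have "AE t in lborel. ennreal (max 0 (f t)) = ennreal (max 0 (- f t))"
    unfolding M_def N_def by (subst (asm) sigma_finite_measure.density_unique_iff[OF sigma_finite_lborel]) auto
  then show ?thesis by eventually_elim (auto simp: max_def split: if_splits)
qed

text \<open>Restriction to \<open>[-n, n]\<close> makes \<open>f\<close> integrable, and a tail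
  integral of the restriction is again an integral of \<open>f\<close> over an interval, possibly
  empty. A Borel representative \<open>g\<close> transfers the question from \<open>lebesgue\<close>
  to \<open>lborel\<close>.\<close>

lemma AE_zero_if_interval_integrals_zero:
  fixes f :: "real \<Rightarrow> real"
  assumes f: "\<And>a b. set_integrable lebesgue {a..b} f"
    and z: "\<And>a b. a \<le> b \<Longrightarrow> integral {a..b} f = 0"
  shows "AE t in lebesgue. f t = 0"
proof -
  have "AE t in lebesgue. indicat_real {- real n..real n} t *\<^sub>R f t = 0" for n
  proof -
    let ?F = "\<lambda>t. indicat_real {- real n..real n} t *\<^sub>R f t"
    have iF: "integrable lebesgue ?F" using f[of "- real n" "real n"] by (simp add: set_integrable_def)
    then have "?F \<in> borel_measurable lebesgue" by auto
    then obtain g where g: "g \<in> borel_measurable borel" "AE t in lborel. ?F t = g t"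
      using completion_ex_borel_measurable_real[of ?F lborel] by auto
    have AE: "AE t in lebesgue. ?F t = g t" using g(2) AE_completion by blast
    have gm: "g \<in> borel_measurable lebesgue" using g(1) by (simp add: measurable_completion)
    have "integrable lebesgue g"
      using iF AE gm integrable_cong_AE[of ?F lebesgue g] by auto
    then have ig: "integrable lborel g" using g(1) by (simp add: integrable_completion)
    have "AE t in lborel. g t = 0"
    proof (rule AE_zero_if_tail_integrals_zero[OF ig])
      fix x
      have "(LINT t:{x<..}|lborel. g t) = (LINT t|lebesgue. indicat_real {x<..} t *\<^sub>R g t)"
        unfolding set_lebesgue_integral_def using g(1) by (intro integral_completion[symmetric]) auto
      also have "\<dots> = (LINT t|lebesgue. indicat_real {max x (- real n)..real n} t *\<^sub>R f t)"
      proof (rule integral_cong_AE)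
        have "{x} \<in> null_sets lebesgue" by (simp add: negligible_iff_null_sets[symmetric])
        then have "AE t in lebesgue. t \<noteq> x" by (rule AE_I') auto
        with AE show "AE t in lebesgue. indicat_real {x<..} t *\<^sub>R g t = indicat_real {max x (- real n)..real n} t *\<^sub>R f t"
          by eventually_elim (auto simp: indicator_def)
        show "(\<lambda>t. indicat_real {x<..} t *\<^sub>R g t) \<in> borel_measurable lebesgue"
          by (intro borel_measurable_scaleR borel_measurable_indicator gm) simp
        show "(\<lambda>t. indicat_real {max x (- real n)..real n} t *\<^sub>R f t) \<in> borel_measurable lebesgue"
          using f[of "max x (- real n)" "real n"] by (auto simp: set_integrable_def)
      qed
      also have "\<dots> = integral {max x (- real n)..real n} f"
        using set_lebesgue_integral_Icc_eq(2)[OF f] by (simp add: set_lebesgue_integral_def)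
      also have "\<dots> = 0"
        using z[of "max x (- real n)" "real n"] by (cases "max x (- real n) \<le> real n") auto
      finally show "(LINT t:{x<..}|lborel. g t) = 0" .
    qed
    then have "AE t in lebesgue. g t = 0" using AE_completion by blast
    with AE show ?thesis by eventually_elim simp
  qed
  then have "AE t in lebesgue. \<forall>n. indicat_real {- real n..real n} t *\<^sub>R f t = 0"
    unfolding AE_all_countable by blast
  then show ?thesis
  proof eventually_elim
    case (elim t)
    obtain n where "\<bar>t\<bar> \<le> real n" using real_arch_simple by blast
    then show ?case using elim[rule_format, of n] by (auto simp: indicator_def)
  qed
qed

lemma weak_deriv_W12_loc:
  assumes "u \<in> W12_loc"
  shows "L2_loc (weak_deriv u)" "has_weak_derivative u (weak_deriv u)"
  using someI_ex[of "\<lambda>g. L2_loc g \<and> has_weak_derivative u g"] assms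
  unfolding W12_loc_def weak_deriv_def by auto

lemma weak_deriv_increment:
  assumes "u \<in> W12_loc" "continuous_on UNIV u" "x \<le> y"
  shows "u y - u x = integral {x..y} (weak_deriv u)"
  using weak_derivative_increment[OF assms(2) weak_deriv_W12_loc[OF assms(1)] assms(3)] .

text \<open>The representative chosen by \<open>weak_deriv\<close> and the classical derivative have
  equal integrals over every interval, hence agree almost everywhere. This makes the energy of an
  explicit C1 competitor computable.\<close>

lemma C1_W12_loc:
  assumes "\<And>x. (u has_real_derivative g x) (at x)" "continuous_on UNIV g"
  shows "u \<in> W12_loc" "continuous_on UNIV u" "AE t in lebesgue. weak_deriv u t = g t"
proof -
  show cu: "continuous_on UNIV u"
    using assms(1) by (meson DERIV_isCont continuous_at_imp_continuous_on)
  have w: "has_weak_derivative u g" using has_weak_derivative_C1[OF assms] .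
  then show W: "u \<in> W12_loc"
    using L2_loc_continuous[OF cu] L2_loc_continuous[OF assms(2)] by (auto simp: W12_loc_def)
  have i: "set_integrable lebesgue {a..b} (weak_deriv u)" "set_integrable lebesgue {a..b} g" for a b
    using L2_loc_set_integrable weak_deriv_W12_loc(1)[OF W] L2_loc_continuous[OF assms(2)] by auto
  have "AE t in lebesgue. weak_deriv u t - g t = 0"
  proof (rule AE_zero_if_interval_integrals_zero)
    show "set_integrable lebesgue {a..b} (\<lambda>t. weak_deriv u t - g t)" for a b
      by (intro set_integral_diff i)
    show "integral {a..b} (\<lambda>t. weak_deriv u t - g t) = 0" if "a \<le> b" for a b
      using weak_deriv_increment[OF W cu that]
        weak_derivative_increment[OF cu L2_loc_continuous[OF assms(2)] w that]
      by (simp add: Henstock_Kurzweil_Integration.integral_diff set_lebesgue_integral_Icc_eq(1) i)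
  qed
  then show "AE t in lebesgue. weak_deriv u t = g t" by simp
qed

section \<open>Calibrations\<close>

definition potential :: "real \<Rightarrow> real \<times> real \<Rightarrow> real" where
  "potential \<Lambda> = (\<lambda>(a, b). (1 - a\<^sup>2 - b\<^sup>2)\<^sup>2 / 4 + (\<Lambda> - 1) / 2 * a\<^sup>2 * b\<^sup>2)"

definition energy_density :: "real \<Rightarrow> real \<Rightarrow> (real \<Rightarrow> real) \<Rightarrow> (real \<Rightarrow> real) \<Rightarrow> real \<Rightarrow> real" where
  "energy_density lam \<Lambda> u v z =
     lam\<^sup>2 * ((weak_deriv u z)\<^sup>2 / 2) + (weak_deriv v z)\<^sup>2 / 2 + potential \<Lambda> (u z, v z)"

lemma energy_eq: "energy lam \<Lambda> u v = (\<integral>\<^sup>+ z. ennreal (energy_density lam \<Lambda> u v z) \<partial>lebesgue)"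
  by (simp add: energy_def energy_density_def potential_def add.assoc)

lemma continuous_potential: "continuous_on A (potential \<Lambda>)"
  unfolding potential_def case_prod_unfold by (intro continuous_intros) auto

lemma energy_density_nonneg: "\<Lambda> \<ge> 1 \<Longrightarrow> energy_density lam \<Lambda> u v z \<ge> 0"
  by (auto simp: energy_density_def potential_def intro!: add_nonneg_nonneg mult_nonneg_nonneg)

lemma energy_density_integrable:
  assumes "u \<in> W12_loc" "v \<in> W12_loc" "continuous_on UNIV u" "continuous_on UNIV v"
  shows "set_integrable lebesgue {a..b} (energy_density lam \<Lambda> u v)"
proof -
  have "continuous_on {a..b} (\<lambda>z. potential \<Lambda> (u z, v z))"
    using assms(3,4) by (intro continuous_on_compose2[OF continuous_potential[of UNIV]] continuous_intros)
      (auto intro: continuous_on_subset)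
  then have "set_integrable lebesgue {a..b}
     (\<lambda>z. lam\<^sup>2 * ((weak_deriv u z)\<^sup>2 / 2) + (weak_deriv v z)\<^sup>2 / 2 + potential \<Lambda> (u z, v z))"
    by (intro set_integral_add set_integrable_mult_right set_integrable_divide
        L2_loc_set_integrable_sq weak_deriv_W12_loc assms absolutely_integrable_continuous_real)
  then show ?thesis unfolding energy_density_def .
qed

section \<open>The calibration inequality along Sobolev curves\<close>

lemma gradient_mean_value:
  fixes F :: "'a::real_normed_vector \<Rightarrow> real"
  assumes "convex B" "P \<in> B" "Q \<in> B"
    and D: "\<And>q. q \<in> B \<Longrightarrow> (F has_derivative F' q) (at q)"
  obtains \<xi> where "\<xi> \<in> B" "F Q - F P = F' \<xi> (Q - P)"
proof -
  define \<gamma> where "\<gamma> s = P + s *\<^sub>R (Q - P)" for s :: real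
  have in_B: "\<gamma> s \<in> B" if "0 \<le> s" "s \<le> 1" for s
    using convexD_alt[OF assms(1,2,3) that] by (simp add: \<gamma>_def algebra_simps)
  have d\<gamma>: "(\<gamma> has_derivative (\<lambda>h. h *\<^sub>R (Q - P))) (at s)" for s
    unfolding \<gamma>_def by (auto intro!: derivative_eq_intros)
  have d: "((F \<circ> \<gamma>) has_derivative (F' (\<gamma> s) \<circ> (\<lambda>h. h *\<^sub>R (Q - P)))) (at s)" if "0 \<le> s" "s \<le> 1" for s
    using d\<gamma> D[OF in_B[OF that]] by (rule diff_chain_at)
  have "\<exists>s\<in>{0<..<1}. (F \<circ> \<gamma>) 1 - (F \<circ> \<gamma>) 0 = (F' (\<gamma> s) \<circ> (\<lambda>h. h *\<^sub>R (Q - P))) (1 - 0)"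
    by (rule mvt_simple[OF zero_less_one has_derivative_at_withinI[OF d]])
  then obtain s where s: "s \<in> {0<..<1}" "F (\<gamma> 1) - F (\<gamma> 0) = F' (\<gamma> s) (Q - P)"
    by auto
  show ?thesis
  proof (rule that[of "\<gamma> s"])
    show "\<gamma> s \<in> B" using s(1) in_B by simp
    show "F Q - F P = F' (\<gamma> s) (Q - P)" using s(2) by (simp add: \<gamma>_def)
  qed
qed

text \<open>Formally the derivative of F(u, v) is Fu u' + Fv v', which Young's inequality bounds by
  lam^2 u'^2 / 2 + v'^2 / 2 + (Fu^2 / lam^2 + Fv^2) / 2; the hypothesis \<open>eik\<close> bounds
  the last term by the potential.\<close>

lemma calibration_on_interval:
  fixes F :: "real \<times> real \<Rightarrow> real"
  assumes lam: "lam > 0" and xy: "x \<le> y"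
    and W: "u \<in> W12_loc" "v \<in> W12_loc" and c: "continuous_on UNIV u" "continuous_on UNIV v"
    and S: "open S" and curve: "\<And>z. z \<in> {x..y} \<Longrightarrow> (u z, v z) \<in> S"
    and D: "\<And>q. q \<in> S \<Longrightarrow> (F has_derivative (\<lambda>(h, k). Fu q * h + Fv q * k)) (at q)"
    and eik: "\<And>q. q \<in> S \<Longrightarrow> (Fu q)\<^sup>2 / lam\<^sup>2 + (Fv q)\<^sup>2 \<le> 2 * potential \<Lambda> q"
  shows "F (u y, v y) - F (u x, v x) \<le> integral {x..y} (energy_density lam \<Lambda> u v)"
proof -
  let ?e = "energy_density lam \<Lambda> u v" and ?p = "weak_deriv u" and ?r = "weak_deriv v"
  let ?w = "\<lambda>z. (u z, v z)"
  have ie: "?e integrable_on {a..b}" for a b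
    using energy_density_integrable[OF W c] set_lebesgue_integral_Icc_eq(1) by blast
  have ip: "?p integrable_on {a..b}" "?r integrable_on {a..b}" for a b
    using L2_loc_set_integrable weak_deriv_W12_loc(1) W set_lebesgue_integral_Icc_eq(1) by blast+
  have cw: "isCont ?w z" for z
    using c by (intro continuous_intros) (auto simp: continuous_on_eq_continuous_at)
  txt \<open>On short intervals \<open>F\<close> is replaced by its gradient at one point, so that no chain rule for
    Sobolev functions is needed.\<close>
  have approx: "F (?w y) - F (?w x) \<le> integral {x..y} ?e + \<epsilon> * (y - x)" if \<epsilon>: "\<epsilon> > 0" for \<epsilon>
  proof -
    \<comment> \<open>Both sides add up over adjacent intervals, so by Bolzano's bisection principle
      only short intervals around each point matter. The error is proportional to length, hence does
      not accumulate.\<close>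
    define P where "P a b \<longleftrightarrow> F (?w b) - F (?w a) \<le> integral {a..b} ?e + \<epsilon> * (b - a)" for a b
    have "P x y"
      using xy
    proof (induction rule: Bolzano)
      case (trans a b d)
      have "integral {a..b} ?e + integral {b..d} ?e = integral {a..d} ?e"
        using trans ie by (intro Henstock_Kurzweil_Integration.integral_combine) auto
      then show ?case using trans by (simp add: P_def algebra_simps)
    next
      case (local x0)
      then have "?w x0 \<in> S" using curve by auto
      then obtain r1 where r1: "r1 > 0" "ball (?w x0) r1 \<subseteq> S"
        using S openE by blast
      \<comment> \<open>The gradient will be frozen at a point \<open>\<xi>\<close> off the curve,
        while the energy sees the potential on the curve; the oscillation of the potential on a
        small ball accounts for the difference.\<close>
      have "isCont (potential \<Lambda>) (?w x0)"
        using continuous_potential[of UNIV] by (simp add: continuous_on_eq_continuous_at)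
      then obtain r2 where r2: "r2 > 0" "\<And>q. dist q (?w x0) < r2 \<Longrightarrow> dist (potential \<Lambda> q) (potential \<Lambda> (?w x0)) < \<epsilon> / 2"
        using \<epsilon> by (metis continuous_at_eps_delta half_gt_zero)
      define B where "B = ball (?w x0) (min r1 r2)"
      have BS: "B \<subseteq> S" using r1 by (auto simp: B_def)
      have osc: "potential \<Lambda> q \<le> potential \<Lambda> q' + \<epsilon>" if "q \<in> B" "q' \<in> B" for q q'
      proof -
        have "dist (potential \<Lambda> q) (potential \<Lambda> (?w x0)) < \<epsilon> / 2"
          "dist (potential \<Lambda> q') (potential \<Lambda> (?w x0)) < \<epsilon> / 2"
          using r2(2)[of q] r2(2)[of q'] that by (auto simp: B_def dist_commute simp del: less_divide_eq_numeral1)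
        then show ?thesis unfolding dist_real_def by linarith
      qed
      obtain d where d: "d > 0" "\<And>z. dist z x0 < d \<Longrightarrow> dist (?w z) (?w x0) < min r1 r2"
        using cw[of x0] r1 r2 unfolding continuous_at_eps_delta by (metis min_less_iff_conj)
      have "P a b" if ab: "a \<le> x0" "x0 \<le> b" "b - a < d" for a b
      proof -
        have inB: "?w z \<in> B" if "z \<in> {a..b}" for z
          using d(2)[of z] that ab by (auto simp: B_def dist_real_def dist_commute)
        obtain \<xi> where \<xi>: "\<xi> \<in> B" "F (?w b) - F (?w a) = (\<lambda>(h, k). Fu \<xi> * h + Fv \<xi> * k) (?w b - ?w a)"
        proof (rule gradient_mean_value[of B "?w a" "?w b" F])
          show "convex B" by (simp add: B_def)
          show "?w a \<in> B" "?w b \<in> B" using inB ab by auto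
        qed (use D BS in blast)
        have "F (?w b) - F (?w a) = Fu \<xi> * integral {a..b} ?p + Fv \<xi> * integral {a..b} ?r"
          using \<xi>(2) weak_deriv_increment[OF W(1) c(1), of a b] weak_deriv_increment[OF W(2) c(2), of a b] ab by simp
        also have "\<dots> = integral {a..b} (\<lambda>z. Fu \<xi> * ?p z + Fv \<xi> * ?r z)"
          by (subst Henstock_Kurzweil_Integration.integral_add)
             (auto intro!: integrable_on_mult_right ip)
        also have "\<dots> \<le> integral {a..b} (\<lambda>z. ?e z + \<epsilon>)"
        proof (rule integral_le)
          show "(\<lambda>z. Fu \<xi> * ?p z + Fv \<xi> * ?r z) integrable_on {a..b}"
            by (intro integrable_add integrable_on_mult_right ip)
          show "(\<lambda>z. ?e z + \<epsilon>) integrable_on {a..b}"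
            by (intro integrable_add ie integrable_const_ivl)
          fix z assume z: "z \<in> {a..b}"
          \<comment> \<open>These squares encode Young's inequality for the two components.\<close>
          have "0 \<le> (lam * ?p z - Fu \<xi> / lam)\<^sup>2 + (?r z - Fv \<xi>)\<^sup>2" by simp
          also have "\<dots> = 2 * (lam\<^sup>2 * ((?p z)\<^sup>2 / 2) + (?r z)\<^sup>2 / 2 - (Fu \<xi> * ?p z + Fv \<xi> * ?r z)) + ((Fu \<xi>)\<^sup>2 / lam\<^sup>2 + (Fv \<xi>)\<^sup>2)"
            using lam by (simp add: power2_diff power_mult_distrib power_divide algebra_simps)
          also have "(Fu \<xi>)\<^sup>2 / lam\<^sup>2 + (Fv \<xi>)\<^sup>2 \<le> 2 * potential \<Lambda> \<xi>"
            using eik \<xi>(1) BS by blast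
          also have "potential \<Lambda> \<xi> \<le> potential \<Lambda> (?w z) + \<epsilon>" using osc \<xi>(1) inB[OF z] by blast
          finally show "Fu \<xi> * ?p z + Fv \<xi> * ?r z \<le> ?e z + \<epsilon>" by (simp add: energy_density_def)
        qed
        also have "\<dots> = integral {a..b} ?e + \<epsilon> * (b - a)"
          using ab by (subst Henstock_Kurzweil_Integration.integral_add) (auto intro!: ie integrable_const_ivl)
        finally show ?thesis unfolding P_def .
      qed
      then show ?case using d(1) by blast
    qed
    then show ?thesis by (simp add: P_def)
  qed
  show ?thesis
  proof (rule field_le_epsilon)
    fix e :: real assume e: "e > 0"
    \<comment> \<open>The denominator \<open>y - x + 1\<close> also covers
      \<open>x = y\<close>.\<close>
    have "F (?w y) - F (?w x) \<le> integral {x..y} ?e + e / (y - x + 1) * (y - x)"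
      using e xy by (intro approx) auto
    also have "e / (y - x + 1) * (y - x) \<le> e" using e xy by (simp add: field_simps)
    finally show "F (?w y) - F (?w x) \<le> integral {x..y} ?e + e" by simp
  qed
qed

lemma energy_ge_interval:
  assumes "u \<in> W12_loc" "v \<in> W12_loc" "continuous_on UNIV u" "continuous_on UNIV v" "\<Lambda> \<ge> 1"
  shows "ennreal (integral {x..y} (energy_density lam \<Lambda> u v)) \<le> energy lam \<Lambda> u v"
proof -
  let ?e = "energy_density lam \<Lambda> u v"
  note i = energy_density_integrable[OF assms(1-4), of x y lam \<Lambda>]
  have "ennreal (integral {x..y} ?e) = ennreal (LINT z|lebesgue. indicat_real {x..y} z *\<^sub>R ?e z)"
    using set_lebesgue_integral_Icc_eq(2)[OF i] by (simp add: set_lebesgue_integral_def)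
  also have "\<dots> = (\<integral>\<^sup>+ z. ennreal (indicat_real {x..y} z *\<^sub>R ?e z) \<partial>lebesgue)"
    using i energy_density_nonneg[OF assms(5)]
    by (intro nn_integral_eq_integral[symmetric]) (auto simp: set_integrable_def)
  also have "\<dots> \<le> energy lam \<Lambda> u v"
    unfolding energy_eq using energy_density_nonneg[OF assms(5)]
    by (intro nn_integral_mono) (auto simp: indicator_def)
  finally show ?thesis .
qed

text \<open>Continuity of \<open>F\<close> at the end states lets the interval inequality pass to
  the limits. The first claim stops at a finite \<open>z\<close>, which measures how far a curve of
  small energy can stray.\<close>

lemma calibration_admissible:
  fixes F :: "real \<times> real \<Rightarrow> real"
  assumes lam: "lam > 0" and L: "\<Lambda> \<ge> 1" and uv: "(u, v) \<in> admissible"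
    and S: "open S" "(0, 1) \<in> S" and curve: "\<And>z. (u z, v z) \<in> S"
    and D: "\<And>q. q \<in> S \<Longrightarrow> (F has_derivative (\<lambda>(h, k). Fu q * h + Fv q * k)) (at q)"
    and eik: "\<And>q. q \<in> S \<Longrightarrow> (Fu q)\<^sup>2 / lam\<^sup>2 + (Fv q)\<^sup>2 \<le> 2 * potential \<Lambda> q"
  shows "ennreal (F (u z, v z) - F (0, 1)) \<le> energy lam \<Lambda> u v"
    and "(1, 0) \<in> S \<Longrightarrow> ennreal (F (1, 0) - F (0, 1)) \<le> energy lam \<Lambda> u v"
proof -
  have a: "u \<in> W12_loc" "v \<in> W12_loc" "continuous_on UNIV u" "continuous_on UNIV v"
    and lims: "((\<lambda>z. (u z, v z)) \<longlongrightarrow> (0, 1)) at_bot" "((\<lambda>z. (u z, v z)) \<longlongrightarrow> (1, 0)) at_top"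
    using uv by (auto simp: admissible_def)
  have cF: "isCont F q" if "q \<in> S" for q
    using D[OF that] has_derivative_continuous by blast
  have le: "ennreal (F (u y, v y) - F (u x, v x)) \<le> energy lam \<Lambda> u v" if "x \<le> y" for x y
    using order.trans[OF ennreal_leI[OF calibration_on_interval[OF lam that a S(1) curve D eik]]
        energy_ge_interval[OF a L]] by simp
  show 1: "ennreal (F (u z, v z) - F (0, 1)) \<le> energy lam \<Lambda> u v" for z
  proof (rule tendsto_upperbound)
    show "((\<lambda>x. ennreal (F (u z, v z) - F (u x, v x))) \<longlongrightarrow> ennreal (F (u z, v z) - F (0, 1))) at_bot"
      by (intro tendsto_ennrealI tendsto_diff tendsto_const isCont_tendsto_compose[OF cF[OF S(2)] lims(1)])
    show "\<forall>\<^sub>F x in at_bot. ennreal (F (u z, v z) - F (u x, v x)) \<le> energy lam \<Lambda> u v"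
      using eventually_le_at_bot[of z] by eventually_elim (rule le)
  qed simp
  assume S1: "(1, 0) \<in> S"
  show "ennreal (F (1, 0) - F (0, 1)) \<le> energy lam \<Lambda> u v"
  proof (rule tendsto_upperbound)
    show "((\<lambda>z. ennreal (F (u z, v z) - F (0, 1))) \<longlongrightarrow> ennreal (F (1, 0) - F (0, 1))) at_top"
      by (intro tendsto_ennrealI tendsto_diff tendsto_const isCont_tendsto_compose[OF cF[OF S1] lims(2)])
  qed (use 1 in simp_all)
qed

section \<open>Lower bound\<close>

text \<open>Since u^2 + v^2 = 1 + t and \<open>lam \<ge> 1\<close>, a calibration h(t) only has to
  satisfy 4 (1 + t) h'(t)^2 \<le> t^2 / 2. A multiple of t^2 works near t = 0 but not for large t;
  dividing by 1 + t^2 keeps h bounded and tames the factor 1 + t. The constant is h(1/2) = 1/50, and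
  h increases with |t|.\<close>

lemma admissible_confined:
  assumes lam: "lam \<ge> 1" and L: "\<Lambda> \<ge> 1" and uv: "(u, v) \<in> admissible"
    and z: "\<bar>(u z)\<^sup>2 + (v z)\<^sup>2 - 1\<bar> \<ge> 1 / 2"
  shows "ennreal (1 / 50) \<le> energy lam \<Lambda> u v"
proof -
  define T :: "real \<times> real \<Rightarrow> real" where "T = (\<lambda>(a, b). a\<^sup>2 + b\<^sup>2 - 1)"
  define h :: "real \<Rightarrow> real" where "h t = t\<^sup>2 / (10 * (1 + t\<^sup>2))" for t
  define h' :: "real \<Rightarrow> real" where "h' t = t / (5 * (1 + t\<^sup>2)\<^sup>2)" for t
  have nz: "1 + t\<^sup>2 > 0" for t :: real by (simp add: add_pos_nonneg)
  have dh: "(h has_real_derivative h' t) (at t)" for t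
    unfolding h_def h'_def using nz[of t]
    by (auto intro!: derivative_eq_intros simp: divide_simps power2_eq_square) (simp add: algebra_simps)
  have dT: "(T has_derivative (\<lambda>(k, l). 2 * fst q * k + 2 * snd q * l)) (at q)" for q
    unfolding T_def case_prod_unfold by (auto intro!: derivative_eq_intros)
  have "ennreal ((h \<circ> T) (u z, v z) - (h \<circ> T) (0, 1)) \<le> energy lam \<Lambda> u v"
  proof (rule calibration_admissible(1)[OF _ L uv open_UNIV])
    fix q :: "real \<times> real"
    show "(h \<circ> T has_derivative (\<lambda>(k, l). (h' (T q) * (2 * fst q)) * k + (h' (T q) * (2 * snd q)) * l)) (at q)"
      using DERIV_compose_FDERIV[OF dh dT, of q]
      by (simp add: comp_def case_prod_unfold algebra_simps)
    obtain a b where q: "q = (a, b)" by (cases q)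
    define t where "t = a\<^sup>2 + b\<^sup>2 - 1"
    have "(h' (T q) * (2 * fst q))\<^sup>2 / lam\<^sup>2 \<le> (h' (T q) * (2 * fst q))\<^sup>2 / 1\<^sup>2"
      using lam by (intro divide_left_mono power_mono) auto
    then have "(h' (T q) * (2 * fst q))\<^sup>2 / lam\<^sup>2 + (h' (T q) * (2 * snd q))\<^sup>2 \<le> (h' t)\<^sup>2 * (4 * (1 + t))"
      by (simp add: q T_def t_def power_mult_distrib algebra_simps)
    also have "\<dots> \<le> (t / (5 * (1 + t\<^sup>2)))\<^sup>2 * (8)"
    proof -
      have "0 \<le> (t - 1 / 2)\<^sup>2 * 2 + t\<^sup>2 * 2 + 1" by (intro add_nonneg_nonneg mult_nonneg_nonneg) auto
      then have "1 + t \<le> 2 * (1 + t\<^sup>2)" by (simp add: power2_diff algebra_simps power2_eq_square)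
      also have "\<dots> \<le> 2 * (1 + t\<^sup>2)\<^sup>2"
        using self_le_power[of "1 + t\<^sup>2" 2] by simp
      finally have "4 * (1 + t) / (1 + t\<^sup>2)\<^sup>2 \<le> 8" using nz[of t] by (simp add: divide_simps)
      then have "(t / (5 * (1 + t\<^sup>2)))\<^sup>2 * (4 * (1 + t) / (1 + t\<^sup>2)\<^sup>2) \<le> (t / (5 * (1 + t\<^sup>2)))\<^sup>2 * 8"
        by (intro mult_left_mono) auto
      moreover have "(t / (5 * s\<^sup>2))\<^sup>2 * (4 * (1 + t)) = (t / (5 * s))\<^sup>2 * (4 * (1 + t) / s\<^sup>2)"
        if "s > 0" for s using that by (simp add: field_simps power2_eq_square)
      ultimately show ?thesis using nz[of t] by (simp only: h'_def)
    qed
    also have "\<dots> \<le> t\<^sup>2 / 2"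
    proof -
      have "\<bar>t\<bar> / (5 * (1 + t\<^sup>2)) \<le> \<bar>t\<bar> / 5"
        using nz[of t] by (intro divide_left_mono) auto
      then have "(\<bar>t\<bar> / (5 * (1 + t\<^sup>2)))\<^sup>2 \<le> (\<bar>t\<bar> / 5)\<^sup>2"
        using nz[of t] by (intro power_mono) auto
      then have "(t / (5 * (1 + t\<^sup>2)))\<^sup>2 \<le> t\<^sup>2 / 25" by (simp add: power_divide)
      then show ?thesis using zero_le_power2[of t] by linarith
    qed
    also have "\<dots> \<le> 2 * potential \<Lambda> q"
    proof -
      have "1 - a\<^sup>2 - b\<^sup>2 = - t" by (simp add: t_def)
      then have "2 * potential \<Lambda> q = t\<^sup>2 / 2 + (\<Lambda> - 1) * (a\<^sup>2 * b\<^sup>2)"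
        by (simp add: q potential_def)
      then show ?thesis using L by simp
    qed
    finally show "(h' (T q) * (2 * fst q))\<^sup>2 / lam\<^sup>2 + (h' (T q) * (2 * snd q))\<^sup>2 \<le> 2 * potential \<Lambda> q" .
  qed (use lam in auto)
  moreover have "1 / 50 \<le> h (T (u z, v z)) - h (T (0, 1))"
  proof -
    have "(1 / 2)\<^sup>2 \<le> \<bar>T (u z, v z)\<bar>\<^sup>2" using z by (intro power_mono) (auto simp: T_def)
    then have "1 / 4 \<le> (T (u z, v z))\<^sup>2" by (simp add: power2_eq_square)
    then show ?thesis using nz[of "T (u z, v z)"] by (simp add: h_def T_def field_simps)
  qed
  ultimately show ?thesis using ennreal_leI order.trans by (metis comp_apply)
qed

text \<open>With \<open>b = v\<^sup>2\<close>, the first function is the norm \<open>sqrt (lam\<^sup>2 v\<^sup>2 + u\<^sup>2)\<close> on the unit circle of the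
  tangent vector \<open>(v, -u)\<close>, and the second a primitive of \<open>- aniso_norm lam b / 2\<close>, the density in
  \<open>b\<close> of the length of the circle divided by \<open>d\<close>.\<close>

definition aniso_norm :: "real \<Rightarrow> real \<Rightarrow> real" where
  "aniso_norm lam b = sqrt (1 + (lam\<^sup>2 - 1) * b)"

definition arc_length :: "real \<Rightarrow> real \<Rightarrow> real" where
  "arc_length lam b = (if lam = 1 then - b / 2 else - ((aniso_norm lam b) ^ 3 / (3 * (lam\<^sup>2 - 1))))"

section \<open>Anisotropic length of the circle and gradient estimates near it\<close>

lemma aniso_norm_sq:
  assumes "lam \<ge> 1" "b \<ge> 0"
  shows "aniso_norm lam b \<ge> 1" "(aniso_norm lam b)\<^sup>2 = 1 + (lam\<^sup>2 - 1) * b"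
proof -
  have "(lam\<^sup>2 - 1) * b \<ge> 0" using assms by (intro mult_nonneg_nonneg) auto
  then show "aniso_norm lam b \<ge> 1" "(aniso_norm lam b)\<^sup>2 = 1 + (lam\<^sup>2 - 1) * b" by (auto simp: aniso_norm_def)
qed

lemma DERIV_aniso_norm:
  assumes "lam \<ge> 1" "b \<ge> 0"
  shows "(aniso_norm lam has_real_derivative (lam\<^sup>2 - 1) / (2 * aniso_norm lam b)) (at b)"
proof -
  have "0 < 1 + (lam\<^sup>2 - 1) * b" using assms by (intro add_pos_nonneg mult_nonneg_nonneg) auto
  then show ?thesis unfolding aniso_norm_def
    by (auto intro!: derivative_eq_intros simp: divide_simps)
qed

lemma DERIV_arc_length:
  assumes "lam \<ge> 1" "b \<ge> 0"
  shows "(arc_length lam has_real_derivative - aniso_norm lam b / 2) (at b)"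
proof (cases "lam = 1")
  case True
  then show ?thesis unfolding arc_length_def aniso_norm_def by (auto intro!: derivative_eq_intros)
next
  case False
  have "lam\<^sup>2 - 1 \<noteq> 0" using assms False by (auto simp: power2_eq_1_iff)
  then show ?thesis unfolding arc_length_def using False aniso_norm_sq(1)[OF assms]
    by (auto intro!: derivative_eq_intros DERIV_aniso_norm[OF assms] simp: divide_simps power2_eq_square)
qed

lemma arc_length_total:
  assumes "lam \<ge> 1"
  shows "arc_length lam 0 - arc_length lam 1 = quotient_coeff lam / 3"
proof (cases "lam = 1")
  case False
  then have "lam\<^sup>2 - 1 \<noteq> 0" using assms by (auto simp: power2_eq_1_iff)
  then show ?thesis using False assms
    by (simp add: arc_length_def aniso_norm_def quotient_coeff_def divide_simps) (simp add: algebra_simps)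
qed (simp add: arc_length_def quotient_coeff_def)

lemma quotient_coeff_pos:
  assumes "lam \<ge> 1"
  shows "quotient_coeff lam > 0"
proof (cases "lam = 1")
  case False
  then have "lam ^ 2 > 1" "lam ^ 3 > 1" using assms by (auto intro!: one_less_power)
  then show ?thesis using False by (simp add: quotient_coeff_def divide_neg_neg)
qed (simp add: quotient_coeff_def)

text \<open>Here a = u^2, b = v^2, and the left side is the squared gradient of the extended length
  function. With t = a + b - 1 one has lam^2 b + a = m^2 + t, so at t = 0 the left side is exactly a
  b. The remaining terms linear in t all contain a b; only the square of the \<open>\<kappa>\<close>
  term does not.\<close>

lemma gradient_sq_bound:
  fixes a b m K \<kappa> lam :: real
  assumes lam: "lam \<ge> 1" and a: "a \<ge> 0" and b: "b \<ge> 0"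
    and t: "\<bar>a + b - 1\<bar> \<le> 1 / 2"
    and m: "m \<ge> 1" "m\<^sup>2 = 1 + (lam\<^sup>2 - 1) * b"
    and \<kappa>: "0 \<le> \<kappa>" "\<kappa> \<le> K" and K: "K \<ge> 2"
  shows "lam\<^sup>2 * a * b\<^sup>2 / m\<^sup>2 + b * (- a / m + (a + b - 1) * \<kappa>)\<^sup>2
     \<le> a * b + 3 * K\<^sup>2 * (a * b * \<bar>a + b - 1\<bar> + (a + b - 1)\<^sup>2)"
proof -
  define t where "t = a + b - 1"
  have ab: "0 \<le> a * b" using a b by simp
  have "lam\<^sup>2 * b + a = m\<^sup>2 + t" using m(2) by (simp add: t_def algebra_simps)
  then have "a * b * (lam\<^sup>2 * b + a) / m\<^sup>2 = a * b * (m\<^sup>2 + t) / m\<^sup>2" by simp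
  then have e: "lam\<^sup>2 * a * b\<^sup>2 / m\<^sup>2 + a\<^sup>2 * b / m\<^sup>2 = a * b + a * b * t / m\<^sup>2"
    using m(1) by (simp add: field_simps power2_eq_square)
  have "lam\<^sup>2 * a * b\<^sup>2 / m\<^sup>2 + b * (- a / m + t * \<kappa>)\<^sup>2
     = (lam\<^sup>2 * a * b\<^sup>2 / m\<^sup>2 + a\<^sup>2 * b / m\<^sup>2) - 2 * (a * b) * t * (\<kappa> / m) + b * (t\<^sup>2 * \<kappa>\<^sup>2)"
    using m(1) by (simp add: field_simps power2_eq_square)
  also have "\<dots> = a * b + a * b * (t * (1 / m\<^sup>2 - 2 * \<kappa> / m)) + b * (t\<^sup>2 * \<kappa>\<^sup>2)"
    unfolding e by (simp add: algebra_simps)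
  also have "\<dots> \<le> a * b + a * b * (\<bar>t\<bar> * (3 * K\<^sup>2)) + 3 * (t\<^sup>2 * K\<^sup>2)"
  proof (intro add_mono mult_left_mono order_refl ab)
    have "\<kappa> / m \<le> K / 1" using \<kappa> m K by (intro frac_le) auto
    moreover have "\<kappa> / m \<ge> 0" using \<kappa> m(1) by simp
    moreover have "0 \<le> 1 / m\<^sup>2" by (rule divide_nonneg_nonneg) (rule zero_le_one, rule zero_le_power2)
    moreover have "1 / m\<^sup>2 \<le> 1" using frac_le[of 1 1 1 "m\<^sup>2"] one_le_power[OF m(1), of 2] by simp
    moreover have "2 * \<kappa> / m = 2 * (\<kappa> / m)" by simp
    ultimately have "\<bar>1 / m\<^sup>2 - 2 * \<kappa> / m\<bar> \<le> 1 + 2 * K" unfolding abs_le_iff using K by linarith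
    also have "\<dots> \<le> 3 * K * K" using mult_mono[of 2 K 2 K] K by (simp add: algebra_simps) (use mult_right_mono[of 2 K K] K in linarith)
    finally have "\<bar>1 / m\<^sup>2 - 2 * \<kappa> / m\<bar> \<le> 3 * K\<^sup>2" by (simp add: power2_eq_square)
    then have "\<bar>t * (1 / m\<^sup>2 - 2 * \<kappa> / m)\<bar> \<le> \<bar>t\<bar> * (3 * K\<^sup>2)"
      unfolding abs_mult by (intro mult_left_mono) auto
    then show "t * (1 / m\<^sup>2 - 2 * \<kappa> / m) \<le> \<bar>t\<bar> * (3 * K\<^sup>2)" by linarith
    have "\<kappa>\<^sup>2 \<le> K\<^sup>2" using \<kappa> by (intro power_mono) auto
    \<comment> \<open>In fact \<open>b \<le> 3 / 2\<close>; the value 3 matches the constant of the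
      linear error.\<close>
    moreover have "b \<le> 3" using abs_le_D1[OF t] a by linarith
    ultimately show "b * (t\<^sup>2 * \<kappa>\<^sup>2) \<le> 3 * (t\<^sup>2 * K\<^sup>2)"
      using b by (intro mult_mono mult_left_mono) auto
  qed (rule a)
  finally show ?thesis unfolding t_def by (simp add: algebra_simps)
qed

text \<open>\<open>P\<close> is u^2 v^2 and \<open>G\<close> the squared gradient. Young's
  inequality splits the mixed term into a relative error \<open>d\<close> of \<open>P\<close>,
  compensated by (1 - d)^2 (1 + d) \<le> 1, and a multiple of t^2, whose total coefficient stays
  below 1/2 for small \<open>d\<close>.\<close>

lemma scaled_gradient_bound:
  fixes P t C d G :: real
  assumes P: "0 \<le> P" "P \<le> 4" and C: "C \<ge> 1" and d: "0 < d" "d \<le> 1 / (4 * C\<^sup>2)"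
    and G: "G \<le> P + C * (P * \<bar>t\<bar> + t\<^sup>2)"
  shows "(d * (1 - d))\<^sup>2 * G \<le> t\<^sup>2 / 2 + d\<^sup>2 * P"
proof -
  have C2: "C\<^sup>2 \<ge> 1" using C by simp
  then have "1 / (4 * C\<^sup>2) \<le> 1 / 4" by (simp add: divide_simps)
  then have d1: "d \<le> 1 / 4" using d by simp
  have dC: "d * C\<^sup>2 \<le> 1 / 4" 
    using mult_right_mono[OF d(2), of "4 * C\<^sup>2"] C2 by (simp split: if_splits)
  \<comment> \<open>The weight \<open>2 * d\<close> is chosen so that \<open>P \<le> 4\<close>
    leaves d C P |t| \<le> C^2 t^2 + d^2 P.\<close>
  have "0 \<le> (C * \<bar>t\<bar> - 2 * d)\<^sup>2" by simp
  then have "4 * d * (C * \<bar>t\<bar>) \<le> C\<^sup>2 * t\<^sup>2 + 4 * d\<^sup>2" by (simp add: power2_diff power_mult_distrib mult_ac)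
  then have "P * (4 * d * (C * \<bar>t\<bar>)) \<le> P * (C\<^sup>2 * t\<^sup>2 + 4 * d\<^sup>2)" using P by (intro mult_left_mono)
  also have "\<dots> \<le> 4 * (C\<^sup>2 * t\<^sup>2) + P * (4 * d\<^sup>2)"
    using mult_right_mono[OF P(2), of "C\<^sup>2 * t\<^sup>2"] by (simp add: algebra_simps)
  finally have 1: "d * (C * (P * \<bar>t\<bar>)) \<le> C\<^sup>2 * t\<^sup>2 + d\<^sup>2 * P" by (simp add: algebra_simps)
  have "d * G \<le> d * (P + C * (P * \<bar>t\<bar> + t\<^sup>2))" using d G by (intro mult_left_mono) auto
  also have "\<dots> \<le> d * P * (1 + d) + (C\<^sup>2 + d * C) * t\<^sup>2"
    using 1 by (simp add: algebra_simps power2_eq_square)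
  finally have "(d * (1 - d)\<^sup>2) * (d * G) \<le> (d * (1 - d)\<^sup>2) * (d * P * (1 + d) + (C\<^sup>2 + d * C) * t\<^sup>2)"
    using d by (intro mult_left_mono) auto
  also have "\<dots> = d\<^sup>2 * P * ((1 - d)\<^sup>2 * (1 + d)) + (1 - d)\<^sup>2 * ((d * C\<^sup>2 + d * (d * C)) * t\<^sup>2)"
    by (simp add: algebra_simps power2_eq_square)
  also have "\<dots> \<le> d\<^sup>2 * P * 1 + 1 * (1 / 2 * t\<^sup>2)"
  proof (intro add_mono mult_left_mono mult_mono)
    have "(1 - d)\<^sup>2 * (1 + d) = (1 - d) * (1 - d\<^sup>2)" by (simp add: power2_eq_square algebra_simps)
    also have "\<dots> \<le> 1 * 1" using d d1 by (intro mult_mono) (auto simp: power_le_one)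
    finally show "(1 - d)\<^sup>2 * (1 + d) \<le> 1" by simp
    show "(1 - d)\<^sup>2 \<le> 1" using d d1 by (intro power_le_one) auto
    have "d * C \<le> d * C\<^sup>2" using C d self_le_power[of C 2] by (intro mult_left_mono) auto
    then have "d * C \<le> 1 / 4" using dC by linarith
    then have "d * (d * C) \<le> 1 * (1 / 4)" using d d1 C by (intro mult_mono) auto
    then show "d * C\<^sup>2 + d * (d * C) \<le> 1 / 2" using dC by simp
  qed (use P d C in auto)
  finally show ?thesis by (simp add: power2_eq_square algebra_simps)
qed

text \<open>A curve leaving the annulus costs at least 1/50, more than the claimed bound by the
  third condition on \<open>d\<close>; any other curve is calibrated by \<open>F\<close>. The
  constant 36 (1 + lam^2)^4 is 4 C^2 for C = 3 K^2 and K = 1 + lam^2.\<close>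

lemma energy_lower_bound:
  assumes lam: "lam \<ge> 1" and uv: "(u, v) \<in> admissible"
    and d: "0 < d" "d \<le> 1 / (36 * (1 + lam\<^sup>2) ^ 4)" "d * quotient_coeff lam / 3 \<le> 1 / 50"
    and L: "\<Lambda> = 1 + d\<^sup>2"
  shows "ennreal (d * (1 - d) * quotient_coeff lam / 3) \<le> energy lam \<Lambda> u v"
proof (cases "\<exists>z. \<bar>(u z)\<^sup>2 + (v z)\<^sup>2 - 1\<bar> \<ge> 1 / 2")
  case True
  have "d * (1 - d) * quotient_coeff lam / 3 \<le> d * 1 * quotient_coeff lam / 3"
    using d quotient_coeff_pos[OF lam] by (intro divide_right_mono mult_right_mono mult_left_mono) auto
  also have "\<dots> \<le> 1 / 50" using d by simp
  finally have "ennreal (d * (1 - d) * quotient_coeff lam / 3) \<le> ennreal (1 / 50)"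
    by (rule ennreal_leI)
  also have "\<dots> \<le> energy lam \<Lambda> u v" using True admissible_confined[OF lam _ uv] L by auto
  finally show ?thesis .
next
  case False
  let ?m = "aniso_norm lam"
  define S where "S = {q :: real \<times> real. \<bar>(fst q)\<^sup>2 + (snd q)\<^sup>2 - 1\<bar> < 1 / 2}"
  define k where "k b = lam\<^sup>2 * b / (2 * ?m b)" for b
  define k' where "k' b = lam\<^sup>2 / (2 * ?m b) - lam\<^sup>2 * b * (lam\<^sup>2 - 1) / (4 * ?m b ^ 3)" for b
  define K where "K = 1 + lam\<^sup>2"
  txt \<open>The factor \<open>k\<close> is the derivative of \<open>F / (d * (1 - d))\<close> in \<open>u\<^sup>2\<close>, chosen to be the value on the circle for which the gradient
    points in the optimal tangential direction.\<close>
  define F where "F q = d * (1 - d) * (arc_length lam ((snd q)\<^sup>2) + ((fst q)\<^sup>2 + (snd q)\<^sup>2 - 1) * k ((snd q)\<^sup>2))" for q :: "real \<times> real"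
  define Gu where "Gu q = lam\<^sup>2 * fst q * (snd q)\<^sup>2 / ?m ((snd q)\<^sup>2)" for q :: "real \<times> real"
  define Gv where "Gv q = 2 * snd q * (- ?m ((snd q)\<^sup>2) / 2 + k ((snd q)\<^sup>2) + ((fst q)\<^sup>2 + (snd q)\<^sup>2 - 1) * k' ((snd q)\<^sup>2))" for q :: "real \<times> real"
  have dk: "(k has_real_derivative k' b) (at b)" if "b \<ge> 0" for b
    unfolding k_def k'_def using aniso_norm_sq(1)[OF lam that]
    by (auto intro!: derivative_eq_intros DERIV_aniso_norm[OF lam that] simp: divide_simps power2_eq_square)
       (simp add: algebra_simps power3_eq_cube)?
  have "ennreal (F (1, 0) - F (0, 1)) \<le> energy lam \<Lambda> u v"
  proof (rule calibration_admissible(2)[OF _ _ uv])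
    show "open S" unfolding S_def by (intro open_Collect_less continuous_intros)
    show "(u z, v z) \<in> S" for z using False by (auto simp: S_def not_le)
    fix q :: "real \<times> real" assume q: "q \<in> S"
    show "(F has_derivative (\<lambda>(h, l). d * (1 - d) * Gu q * h + d * (1 - d) * Gv q * l)) (at q)"
    proof -
      have b: "(snd q)\<^sup>2 \<ge> 0" by simp
      have D: "((\<lambda>q. f ((snd q)\<^sup>2)) has_derivative (\<lambda>h. 2 * snd q * snd h * f')) (at q)"
        if "(f has_real_derivative f') (at ((snd q)\<^sup>2))" for f f'
        by (rule DERIV_compose_FDERIV[where g = "\<lambda>q. (snd q)\<^sup>2", OF that]) (auto intro!: derivative_eq_intros)
      have Gu': "Gu q = 2 * fst q * k ((snd q)\<^sup>2)" by (simp add: Gu_def k_def)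
      show ?thesis
        unfolding F_def
        by (rule derivative_eq_intros D[OF dk[OF b]] D[OF DERIV_arc_length[OF lam b]] refl)+
           (auto simp: fun_eq_iff Gu' Gv_def algebra_simps)
    qed
    define a b t m where "a = (fst q)\<^sup>2" and "b = (snd q)\<^sup>2" and "t = a + b - 1" and "m = ?m b"
    \<comment> \<open>This is the coefficient of \<open>t\<close> in \<open>Gv q / snd q\<close>:
      \<open>1 / m\<close> comes from \<open>- m + 2 * k b\<close>, and \<open>2 * k' b\<close> from
      differentiating \<open>k\<close>.\<close>
    define \<kappa> where "\<kappa> = 1 / m + 2 * k' b"
    have ab: "a \<ge> 0" "b \<ge> 0" "\<bar>a + b - 1\<bar> \<le> 1 / 2" using q by (auto simp: a_def b_def S_def)
    have m: "m \<ge> 1" "m\<^sup>2 = 1 + (lam\<^sup>2 - 1) * b"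
      unfolding m_def using aniso_norm_sq[OF lam ab(2)] by auto
    have \<kappa>: "0 \<le> \<kappa>" "\<kappa> \<le> K"
    proof -
      \<comment> \<open>As the anisotropic share of m^2, \<open>s\<close> lies in [0, 1], and
        \<open>k' b\<close> equals lam^2 (1 - s / 2) / (2 m).\<close>
      define s where "s = (lam\<^sup>2 - 1) * b / m\<^sup>2"
      have cb: "0 \<le> (lam\<^sup>2 - 1) * b" using lam ab by (intro mult_nonneg_nonneg) auto
      have s: "0 \<le> s" "s \<le> 1" using cb m unfolding s_def by (simp_all add: divide_simps)
      have "\<kappa> = (1 + lam\<^sup>2 * (1 - s / 2)) / m"
        unfolding \<kappa>_def k'_def m_def[symmetric] s_def using m(1)
        by (simp add: divide_simps power2_eq_square power3_eq_cube) (simp add: algebra_simps)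
      moreover have "0 \<le> 1 + lam\<^sup>2 * (1 - s / 2)" "1 + lam\<^sup>2 * (1 - s / 2) \<le> K"
        using s by (auto simp: K_def intro!: add_nonneg_nonneg mult_nonneg_nonneg mult_left_le)
      ultimately show "0 \<le> \<kappa>" "\<kappa> \<le> K"
        using m(1) frac_le[of K "1 + lam\<^sup>2 * (1 - s / 2)" 1 m] by auto
    qed
    have "Gv q = snd q * (- a / m + t * \<kappa>)"
    proof -
      \<comment> \<open>The formula for m^2 gives lam^2 b - m^2 = b - 1 = t - a.\<close>
      have "- m / 2 + k b = (t - a) / (2 * m)"
        using m(1) m(2) by (simp add: k_def m_def[symmetric] t_def field_simps power2_eq_square)
      moreover have "Gv q = snd q * (2 * (- m / 2 + k b) + 2 * t * k' b)"
        unfolding Gv_def a_def[symmetric] b_def[symmetric] m_def[symmetric] t_def[symmetric]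
        by (simp add: algebra_simps)
      ultimately have "Gv q = snd q * (2 * ((t - a) / (2 * m)) + 2 * t * k' b)" by (simp only:)
      then show ?thesis by (simp add: \<kappa>_def algebra_simps diff_divide_distrib)
    qed
    then have Gv: "(Gv q)\<^sup>2 = b * (- a / m + t * \<kappa>)\<^sup>2" by (simp add: power_mult_distrib b_def)
    have Gu: "(Gu q)\<^sup>2 / lam\<^sup>2 = lam\<^sup>2 * a * b\<^sup>2 / m\<^sup>2"
      unfolding Gu_def b_def[symmetric] m_def[symmetric] using lam
      by (simp add: a_def field_simps power2_eq_square)
    have "K \<ge> 2" using lam by (simp add: K_def)
    then have bound: "(Gu q)\<^sup>2 / lam\<^sup>2 + (Gv q)\<^sup>2 \<le> a * b + 3 * K\<^sup>2 * (a * b * \<bar>t\<bar> + t\<^sup>2)"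
      unfolding Gu Gv t_def using gradient_sq_bound[OF lam ab m \<kappa>] by simp
    have "(d * (1 - d))\<^sup>2 * ((Gu q)\<^sup>2 / lam\<^sup>2 + (Gv q)\<^sup>2) \<le> t\<^sup>2 / 2 + d\<^sup>2 * (a * b)"
    proof (rule scaled_gradient_bound[OF _ _ _ d(1) _ bound])
      have "a \<le> 2" "b \<le> 2" using ab(1,2) abs_le_D1[OF ab(3)] by linarith+
      then show "a * b \<le> 4" using ab mult_mono[of a 2 b 2] by simp
      have "1 \<le> K\<^sup>2" using \<open>K \<ge> 2\<close> by (intro one_le_power) auto
      then show "1 \<le> 3 * K\<^sup>2" by simp
      show "d \<le> 1 / (4 * (3 * K\<^sup>2)\<^sup>2)" using d(2) by (simp add: K_def power_mult_distrib)
    qed (use ab in simp)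
    moreover have "2 * potential \<Lambda> q = t\<^sup>2 / 2 + d\<^sup>2 * (a * b)"
    proof -
      have "1 - a - b = - t" by (simp add: t_def)
      then show ?thesis by (simp add: potential_def case_prod_unfold L a_def b_def)
    qed
    ultimately show "(d * (1 - d) * Gu q)\<^sup>2 / lam\<^sup>2 + (d * (1 - d) * Gv q)\<^sup>2 \<le> 2 * potential \<Lambda> q"
      by (simp only: power_mult_distrib distrib_left times_divide_eq_right)
  qed (use lam L in \<open>auto simp: S_def\<close>)
  \<comment> \<open>Both end states lie on the circle, where the correction by \<open>k\<close>
    vanishes.\<close>
  also have "F (1, 0) - F (0, 1) = d * (1 - d) * quotient_coeff lam / 3"
    using arc_length_total[OF lam] by (simp add: F_def right_diff_distrib[symmetric])
  finally show ?thesis .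
qed

section \<open>Upper bound\<close>

text \<open>In the coordinate \<open>tan \<theta> = exp Y\<close> on the circle, equality in the calibration inequality becomes
  an autonomous equation whose right-hand side lies between \<open>d / lam\<close> and \<open>d\<close>.\<close>

lemma optimal_profile_exists:
  assumes lam: "lam \<ge> 1" and d: "d > 0"
  obtains Y where
    "\<And>z. (Y has_real_derivative d / aniso_norm lam (1 / (1 + exp (2 * Y z)))) (at z)"
    "filterlim Y at_top at_top" "filterlim Y at_bot at_bot"
proof -
  define M where "M y = aniso_norm lam (1 / (1 + exp (2 * y)))" for y
  have M1: "M y \<ge> 1" for y
    unfolding M_def by (intro aniso_norm_sq(1) lam) (simp add: add_pos_pos less_imp_le)
  have cM: "isCont (\<lambda>y. M y / d) y" for y
  proof -
    have "1 + exp (2 * y) \<noteq> 0" using exp_gt_zero[of "2 * y"] by linarith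
    then show ?thesis unfolding M_def aniso_norm_def using d by (intro continuous_intros) auto
  qed
  \<comment> \<open>The equation is separable: \<open>Z\<close> gives the position z as a function
    of the value of the profile, and the profile is its inverse.\<close>
  obtain Z where Z: "\<And>y. (Z has_vector_derivative M y / d) (at y)"
    using einterval_antiderivative[of "-\<infinity>" "\<infinity>" "\<lambda>y. M y / d"] cM by auto
  then have dZ: "(Z has_real_derivative M y / d) (at y)" for y
    by (simp add: has_real_derivative_iff_has_vector_derivative)
  have cZ: "isCont Z y" for y using dZ DERIV_isCont by blast
  \<comment> \<open>The slope of \<open>Z\<close> is at least \<open>1 / d\<close>, so
    \<open>Z\<close> is injective and also onto; hence the profile exists on the whole line.\<close>
  have growth: "(y - x) / d \<le> Z y - Z x" if "x \<le> y" for x y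
  proof -
    have "Z x - x / d \<le> Z y - y / d"
    proof (rule DERIV_nonneg_imp_nondecreasing[OF that])
      fix t
      have "((\<lambda>t. Z t - t / d) has_real_derivative M t / d - 1 / d) (at t)"
        by (intro DERIV_diff dZ DERIV_cdivide DERIV_ident)
      moreover have "0 \<le> M t / d - 1 / d"
        using M1[of t] d by (simp add: divide_right_mono)
      ultimately show "\<exists>y. ((\<lambda>t. Z t - t / d) has_real_derivative y) (at t) \<and> 0 \<le> y" by blast
    qed
    then show ?thesis by (simp add: diff_divide_distrib)
  qed
  have mono: "strict_mono Z"
  proof (rule strict_monoI)
    fix x y :: real assume "x < y"
    moreover from this have "0 < (y - x) / d" using d by simp
    ultimately show "Z x < Z y" using growth[of x y] by linarith
  qed
  have "c \<in> range Z" for c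
  proof -
    \<comment> \<open>By \<open>growth\<close>, moving from 0 by d (c - Z 0) changes
      \<open>Z\<close> by at least the required c - Z 0 in absolute value.\<close>
    define l r where "l = min 0 (d * (c - Z 0))" and "r = max 0 (d * (c - Z 0))"
    have "l / d \<le> c - Z 0" "c - Z 0 \<le> r / d"
      using d by (auto simp: l_def r_def pos_divide_le_eq pos_le_divide_eq mult.commute)
    then have "Z l \<le> c" "c \<le> Z r"
      using growth[of l 0] growth[of 0 r] by (auto simp: l_def r_def)
    moreover have "l \<le> r" by (simp add: l_def r_def)
    ultimately obtain y where "Z y = c" using IVT[of Z l c r] cZ by blast
    then show "c \<in> range Z" by (rule range_eqI[OF sym])
  qed
  then have "surj Z" by blast
  define Y where "Y = inv Z"
  have ZY: "Z (Y z) = z" for z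
    unfolding Y_def by (rule surj_f_inv_f[OF \<open>surj Z\<close>])
  have YZ: "Y (Z y) = y" for y
    unfolding Y_def using strict_mono_imp_inj_on[OF mono] by simp
  have cY: "isCont Y z" for z
  proof -
    have "isCont Y (Z (Y z))" by (rule isCont_inverse_function[where d = 1]) (simp_all add: YZ cZ)
    then show ?thesis by (simp only: ZY)
  qed
  show ?thesis
  proof (rule that[of Y])
    fix z
    have "M (Y z) / d \<noteq> 0" using M1[of "Y z"] d by auto
    then have "(Y has_real_derivative inverse (M (Y z) / d)) (at z)"
      by (intro DERIV_inverse_function[where f = Z and a = "z - 1" and b = "z + 1"] dZ cY ZY) auto
    then show "(Y has_real_derivative d / aniso_norm lam (1 / (1 + exp (2 * Y z)))) (at z)"
      by (simp add: M_def)
  next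
    have Y_le: "Y a \<le> Y b" if "a \<le> b" for a b
      using strict_mono_less_eq[OF mono, of "Y a" "Y b"] ZY that by simp
    show "filterlim Y at_top at_top"
      unfolding filterlim_at_top
    proof
      fix c show "\<forall>\<^sub>F z in at_top. c \<le> Y z"
        using eventually_ge_at_top[of "Z c"] by eventually_elim (metis Y_le YZ)
    qed
    show "filterlim Y at_bot at_bot"
      unfolding filterlim_at_bot
    proof
      fix c show "\<forall>\<^sub>F z in at_bot. Y z \<le> c"
        using eventually_le_at_bot[of "Z c"] by eventually_elim (metis Y_le YZ)
    qed
  qed
qed

text \<open>The competitor is (sin \<theta>, cos \<theta>) with tan \<theta> = exp Y. Its energy
  density is an exact derivative, so its energy is read off from the limits at infinity.\<close>

lemma sigma_inf_upper_bound:
  assumes lam: "lam \<ge> 1" and d: "d > 0" and L: "\<Lambda> = 1 + d\<^sup>2"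
  shows "sigma_inf lam \<Lambda> \<le> ennreal (d * quotient_coeff lam / 3)"
proof -
  obtain Y where dY: "\<And>z. (Y has_real_derivative d / aniso_norm lam (1 / (1 + exp (2 * Y z)))) (at z)"
    and Y_lims: "filterlim Y at_top at_top" "filterlim Y at_bot at_bot"
    using optimal_profile_exists[OF lam d] by blast
  define R :: "real \<Rightarrow> real" where "R y = sqrt (1 + exp (2 * y))" for y
  define U where "U y = exp y / R y" for y
  define V where "V y = 1 / R y" for y
  define M where "M y = aniso_norm lam ((V y)\<^sup>2)" for y
  have R: "R y > 0" "(R y)\<^sup>2 = 1 + (exp y)\<^sup>2" for y
    by (auto simp: R_def add_pos_pos exp_double add_nonneg_nonneg)
  have V2: "(V y)\<^sup>2 = 1 / (1 + exp (2 * y))" for y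
    by (simp add: V_def power_divide R exp_double)
  have UV1: "(U y)\<^sup>2 + (V y)\<^sup>2 = 1" for y
    using R[of y] by (simp add: U_def V_def power_divide add_divide_distrib[symmetric])
      (metis add.commute add_pos_nonneg less_numeral_extra(1,3) divide_self zero_le_power2)
  have M: "M y \<ge> 1" "(M y)\<^sup>2 = lam\<^sup>2 * (V y)\<^sup>2 + (U y)\<^sup>2" for y
    using aniso_norm_sq[OF lam, of "(V y)\<^sup>2"] UV1[of y] by (auto simp: M_def algebra_simps)
  have dY': "(Y has_real_derivative d / M (Y z)) (at z)" for z
    using dY by (simp add: M_def V2)
  have dR: "(R has_real_derivative (exp y)\<^sup>2 / R y) (at y)" for y
  proof -
    have "0 < 1 + exp (2 * y)" by (simp add: add_pos_pos)
    then show ?thesis unfolding R_def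
      by (auto intro!: derivative_eq_intros simp: exp_double divide_simps power2_eq_square)
  qed
  \<comment> \<open>With y = log tan \<theta> one has d\<theta>/dy = sin \<theta> cos \<theta>,
    which yields the derivatives of \<open>U\<close> and \<open>V\<close>.\<close>
  have dU: "(U has_real_derivative U y * (V y)\<^sup>2) (at y)" for y
  proof -
    have "(U has_real_derivative (exp y * R y - exp y * ((exp y)\<^sup>2 / R y)) / (R y * R y)) (at y)"
      unfolding U_def using R(1)[of y] by (intro DERIV_divide dR DERIV_exp) auto
    moreover have "(exp y * R y - exp y * ((exp y)\<^sup>2 / R y)) / (R y * R y) = exp y * ((R y)\<^sup>2 - (exp y)\<^sup>2) / (R y)^3"
      using R(1)[of y] by (simp add: field_simps power2_eq_square power3_eq_cube)
    moreover have "\<dots> = U y * (V y)\<^sup>2"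
      by (simp add: R(2)) (simp add: U_def V_def power_divide power2_eq_square power3_eq_cube)
    ultimately show ?thesis by simp
  qed
  have dV: "(V has_real_derivative - ((U y)\<^sup>2 * V y)) (at y)" for y
    unfolding V_def U_def using R(1)[of y]
    by (auto intro!: derivative_eq_intros dR simp: field_simps power2_eq_square)
  define u v where "u z = U (Y z)" and "v z = V (Y z)" for z
  define u' v' where "u' z = u z * (v z)\<^sup>2 * (d / M (Y z))" and "v' z = - ((u z)\<^sup>2 * v z) * (d / M (Y z))" for z
  have du: "(u has_real_derivative u' z) (at z)" and dv: "(v has_real_derivative v' z) (at z)" for z
    unfolding u_def v_def u'_def v'_def
    by (rule DERIV_chain2[OF dU dY'] DERIV_chain2[OF dV dY'])+
  have cu: "continuous_on UNIV u" and cv: "continuous_on UNIV v"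
    using du dv by (meson DERIV_isCont continuous_at_imp_continuous_on)+
  have cM: "continuous_on UNIV (\<lambda>z. M (Y z))"
    unfolding M_def aniso_norm_def using cv by (intro continuous_intros) (simp add: v_def)
  have cu': "continuous_on UNIV u'" and cv': "continuous_on UNIV v'"
  proof -
    have "M y \<noteq> 0" for y using M(1)[of y] by auto
    then have "continuous_on UNIV (\<lambda>z. d / M (Y z))"
      by (intro continuous_on_divide continuous_on_const cM) blast
    note c = this continuous_on_mult continuous_on_minus continuous_on_power cu cv
    show "continuous_on UNIV u'" unfolding u'_def by (intro c)
    show "continuous_on UNIV v'" unfolding v'_def by (intro c)
  qed
  note Cu = C1_W12_loc[OF du cu'] and Cv = C1_W12_loc[OF dv cv']
  have bot: "(U \<longlongrightarrow> 0) at_bot" "(V \<longlongrightarrow> 1) at_bot"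
  proof -
    have "filterlim (\<lambda>y::real. 2 * y) at_bot at_bot"
      by (rule filterlim_tendsto_pos_mult_at_bot[OF tendsto_const]) (auto simp: filterlim_ident)
    from filterlim_compose[OF exp_at_bot this]
    have "(R \<longlongrightarrow> sqrt (1 + 0)) at_bot"
      unfolding R_def by (intro tendsto_real_sqrt tendsto_add tendsto_const)
    then have R1: "(R \<longlongrightarrow> 1) at_bot" by simp
    show "(U \<longlongrightarrow> 0) at_bot"
      using tendsto_divide[OF exp_at_bot R1] by (simp add: U_def[abs_def])
    show "(V \<longlongrightarrow> 1) at_bot"
      using tendsto_divide[OF tendsto_const R1, of 1] by (simp add: V_def[abs_def])
  qed
  \<comment> \<open>Reflection swaps \<theta> and \<pi>/2 - \<theta>, so the limits at the top
    follow from those at the bottom.\<close>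
  have reflect: "U y = V (- y)" "V y = U (- y)" for y
  proof -
    have "R (- y) = R y / exp y"
    proof -
      have "1 + exp (- (2 * y)) = (1 + exp (2 * y)) / (exp y)\<^sup>2"
        unfolding exp_minus exp_double by (simp add: field_simps)
      then show ?thesis by (simp add: R_def real_sqrt_divide)
    qed
    then show "U y = V (- y)" "V y = U (- y)" by (auto simp: U_def V_def exp_minus)
  qed
  have top: "(U \<longlongrightarrow> 1) at_top" "(V \<longlongrightarrow> 0) at_top"
    by (subst ext[of _ "\<lambda>y. V (- y)", OF reflect(1)] ext[of V "\<lambda>y. U (- y)", OF reflect(2)],
        rule filterlim_compose[OF _ filterlim_uminus_at_bot_at_top], rule bot)+
  have lims: "(u \<longlongrightarrow> 0) at_bot" "(v \<longlongrightarrow> 1) at_bot" "(u \<longlongrightarrow> 1) at_top" "(v \<longlongrightarrow> 0) at_top"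
    unfolding u_def v_def
    by (rule filterlim_compose[OF bot(1) Y_lims(2)] filterlim_compose[OF bot(2) Y_lims(2)]
       filterlim_compose[OF top(1) Y_lims(1)] filterlim_compose[OF top(2) Y_lims(1)])+
  have adm: "(u, v) \<in> admissible"
    unfolding admissible_def using Cu Cv lims by (auto intro!: tendsto_Pair)
  \<comment> \<open>Equipartition: the kinetic and potential parts both equal
    \<open>f z / 2\<close>, as in the equality case of the calibration.\<close>
  define f where "f z = d\<^sup>2 * ((u z)\<^sup>2 * (v z)\<^sup>2)" for z
  have density: "energy_density lam \<Lambda> u v z = f z"
    if "weak_deriv u z = u' z" "weak_deriv v z = v' z" for z
  proof -
    have "lam\<^sup>2 * ((u' z)\<^sup>2 / 2) + (v' z)\<^sup>2 / 2
        = (d\<^sup>2 * ((u z)\<^sup>2 * (v z)\<^sup>2) / 2) * ((lam\<^sup>2 * (v z)\<^sup>2 + (u z)\<^sup>2) / (M (Y z))\<^sup>2)"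
      using M(1)[of "Y z"] by (simp add: u'_def v'_def field_simps power2_eq_square)
    also have "(lam\<^sup>2 * (v z)\<^sup>2 + (u z)\<^sup>2) / (M (Y z))\<^sup>2 = 1"
      using M(1)[of "Y z"] unfolding u_def v_def M(2)[symmetric] by simp
    finally have "lam\<^sup>2 * ((u' z)\<^sup>2 / 2) + (v' z)\<^sup>2 / 2 = f z / 2" by (simp add: f_def)
    moreover have "potential \<Lambda> (u z, v z) = f z / 2"
      using UV1[of "Y z"] by (simp add: potential_def f_def L u_def v_def diff_diff_eq)
    ultimately show ?thesis using that by (simp add: energy_density_def)
  qed
  \<comment> \<open>This is the calibration along the circle without the factor 1 - d.\<close>
  define G where "G z = d * arc_length lam ((v z)\<^sup>2)" for z
  have dG: "(G has_real_derivative f z) (at z)" for z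
  proof -
    have "(G has_real_derivative d * ((- aniso_norm lam ((v z)\<^sup>2) / 2) * (2 * v z * v' z))) (at z)"
      unfolding G_def
      by (intro DERIV_cmult DERIV_chain2[where f = "arc_length lam"] DERIV_arc_length lam)
         (auto intro!: derivative_eq_intros dv)
    moreover have "d * ((- aniso_norm lam ((v z)\<^sup>2) / 2) * (2 * v z * v' z)) = f z"
      using M(1)[of "Y z"] by (simp add: v'_def f_def M_def v_def power2_eq_square)
    ultimately show ?thesis by simp
  qed
  have cf: "continuous_on UNIV f" unfolding f_def by (intro continuous_intros cu cv)
  have cG: "isCont (arc_length lam) b" if "b \<ge> 0" for b
    using DERIV_arc_length[OF lam that] DERIV_isCont by blast
  have "((\<lambda>z. (v z)\<^sup>2) \<longlongrightarrow> 1) at_bot" "((\<lambda>z. (v z)\<^sup>2) \<longlongrightarrow> 0) at_top"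
    using lims by (auto intro!: tendsto_eq_intros)
  then have G_lims: "(G \<longlongrightarrow> d * arc_length lam 1) at_bot" "(G \<longlongrightarrow> d * arc_length lam 0) at_top"
    unfolding G_def by (auto intro!: tendsto_mult_left isCont_tendsto_compose[OF cG])
  have f0: "f z \<ge> 0" for z by (simp add: f_def)
  have "set_integrable lborel (einterval (-\<infinity>) \<infinity>) f"
    "(LBINT z=-\<infinity>..\<infinity>. f z) = d * arc_length lam 0 - d * arc_length lam 1"
    by (rule interval_integral_FTC_nonneg[where F = G];
        use cf f0 G_lims dG in \<open>simp add: continuous_on_eq_continuous_at ereal_tendsto_simps\<close>)+
  then have i: "integrable lborel f" "(LINT z|lborel. f z) = d * quotient_coeff lam / 3"
    using arc_length_total[OF lam]
    by (auto simp: set_integrable_def interval_lebesgue_integral_def set_lebesgue_integral_def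
        right_diff_distrib[symmetric])
  have nn: "(\<integral>\<^sup>+ z. ennreal (f z) \<partial>lebesgue) = ennreal (d * quotient_coeff lam / 3)"
    unfolding nn_integral_completion i(2)[symmetric] using f0
    by (intro nn_integral_eq_integral i(1)) simp
  have "AE z in lebesgue. energy_density lam \<Lambda> u v z = f z"
    using Cu(3) Cv(3) by eventually_elim (rule density)
  then have "energy lam \<Lambda> u v = (\<integral>\<^sup>+ z. ennreal (f z) \<partial>lebesgue)"
    unfolding energy_eq by (intro nn_integral_cong_AE) auto
  moreover have "sigma_inf lam \<Lambda> \<le> energy lam \<Lambda> u v"
    unfolding sigma_inf_def using adm by (auto intro: INF_lower2)
  ultimately show ?thesis using nn by simp
qed

text \<open>Both bounds together place the difference between -d^2 q / 3 and 0, where q is the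
  coefficient and d^2 = \<Lambda> - 1. Finiteness is stated separately because
  \<open>enn2real\<close> sends \<open>top\<close> to 0.\<close>

theorem proposition5p1:
  fixes lam :: real
  assumes "lam \<ge> 1"
  shows "(\<forall>\<^sub>F \<Lambda> in at_right 1. sigma_inf lam \<Lambda> < top) \<and>
    (\<lambda>\<Lambda>. enn2real (sigma_inf lam \<Lambda>) - 1 / 3 * quotient_coeff lam * (\<Lambda> - 1) powr (1 / 2))
      \<in> O[at_right 1](\<lambda>\<Lambda>. \<Lambda> - 1)"
proof -
  let ?q = "quotient_coeff lam"
  have q: "?q > 0" by (rule quotient_coeff_pos[OF assms])
  \<comment> \<open>The last two entries are the smallness conditions of the lower bound;
    \<open>3 / (50 * ?q)\<close> puts the main term below the confinement threshold 1/50.\<close>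
  define d0 where "d0 = min 1 (min (1 / (36 * (1 + lam\<^sup>2) ^ 4)) (3 / (50 * ?q)))"
  have "1 + lam\<^sup>2 > 0" by (simp add: add_pos_nonneg)
  then have d0: "d0 > 0" using q by (simp add: d0_def)
  have bounds: "sigma_inf lam \<Lambda> < top \<and>
      \<bar>enn2real (sigma_inf lam \<Lambda>) - 1 / 3 * ?q * (\<Lambda> - 1) powr (1 / 2)\<bar> \<le> ?q / 3 * \<bar>\<Lambda> - 1\<bar>"
    if L: "1 < \<Lambda>" "\<Lambda> < 1 + d0\<^sup>2" for \<Lambda>
  proof -
    define d where "d = sqrt (\<Lambda> - 1)"
    have d: "d > 0" "\<Lambda> = 1 + d\<^sup>2" using L by (auto simp: d_def)
    have "d\<^sup>2 < d0\<^sup>2" using L d by simp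
    then have "d < d0" using d0 by (simp add: power_less_imp_less_base)
    then have small: "d \<le> 1" "d \<le> 1 / (36 * (1 + lam\<^sup>2) ^ 4)" "d \<le> 3 / (50 * ?q)"
      by (auto simp: d0_def)
    then have "d * ?q / 3 \<le> 1 / 50" using q by (simp add: field_simps)
    then have lower: "ennreal (d * (1 - d) * ?q / 3) \<le> sigma_inf lam \<Lambda>"
      unfolding sigma_inf_def using energy_lower_bound[OF assms _ d(1) small(2) _ d(2)]
      by (auto intro!: INF_greatest)
    have upper: "sigma_inf lam \<Lambda> \<le> ennreal (d * ?q / 3)"
      using sigma_inf_upper_bound[OF assms d] .
    have fin: "sigma_inf lam \<Lambda> < top" using upper ennreal_less_top le_less_trans by blast
    then obtain s where s: "s \<ge> 0" "sigma_inf lam \<Lambda> = ennreal s"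
      by (metis ennreal_cases infinity_ennreal_def less_irrefl)
    have "d * (1 - d) * ?q / 3 \<le> s" "s \<le> d * ?q / 3"
      using lower upper s d(1) q by (auto simp: ennreal_le_iff)
    then have "\<bar>s - 1 / 3 * ?q * d\<bar> \<le> ?q / 3 * d\<^sup>2"
      using q by (simp add: abs_le_iff algebra_simps power2_eq_square)
    moreover have "(\<Lambda> - 1) powr (1 / 2) = d" using L by (simp add: d_def powr_half_sqrt)
    ultimately show ?thesis using fin s d by simp
  qed
  have ev: "\<forall>\<^sub>F \<Lambda> in at_right 1. sigma_inf lam \<Lambda> < top \<and>
      \<bar>enn2real (sigma_inf lam \<Lambda>) - 1 / 3 * ?q * (\<Lambda> - 1) powr (1 / 2)\<bar> \<le> ?q / 3 * \<bar>\<Lambda> - 1\<bar>"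
    using bounds d0 by (intro eventually_at_rightI[of 1 "1 + d0\<^sup>2"]) auto
  show ?thesis
  proof
    show "\<forall>\<^sub>F \<Lambda> in at_right 1. sigma_inf lam \<Lambda> < top"
      using ev by eventually_elim simp
    show "(\<lambda>\<Lambda>. enn2real (sigma_inf lam \<Lambda>) - 1 / 3 * ?q * (\<Lambda> - 1) powr (1 / 2))
      \<in> O[at_right 1](\<lambda>\<Lambda>. \<Lambda> - 1)"
      using ev by (intro bigoI[where c = "?q / 3"]) (auto elim!: eventually_mono)
  qed
qed

end
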